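(* Let $r\ge 1$ and $L\ge 1$ be integers and let $s$ be a nonnegative integer or half-integer, so $2s\in\mathbb{Z}_{\ge 0}$. Let $\lambda=(\lambda_1\ge\lambda_2\ge\dots\ge\lambda_{r+1}\ge 0)$ be a partition of $2sL$ with at most $r+1$ parts, and let $\vec M=(M_1,\dots,M_r)$ be determined by $\lambda_i=M_{i-1}-M_i$ for $i=1,\dots,r+1$, with the convention $M_0=2sL$ and $M_{r+1}=0$. Then the multiplicity $\mu_\lambda$ of the irreducible representation $V_\lambda$ of the Lie algebra $A_r$ in the tensor power $V_{(2s)}^{\otimes L}$ is $$\mu_\lambda=\mathcal{D}_{R_{A_r}(t)}\,c_{s,L}(\vec M).$$
   Context: $A_r=\mathfrak{sl}(r+1)$ over $\mathbb{C}$. For a partition $\lambda=(\lambda_1\ge\dots\ge\lambda_{r+1}\ge0)$, $V_\lambda$ is the irreducible representation of $A_r$ with highest weight $\sum_i\lambda_iL_i$, where $L_1,\dots,L_{r+1}$ are the standard weights with $L_1+\dots+L_{r+1}=0$; its character is the Schur polynomial $\chi_\lambda(x_1,\dots,x_{r+1})$. (Labels with $r+1$ rows are redundant: $\lambda$ and $(\lambda_1-\lambda_{r+1},\dots,\lambda_r-\lambda_{r+1},0)$ give the same representation. Among partitions of the fixed size $2sL$ the label is unique.) $V_{(2s)}\cong\mathrm{Sym}^{2s}(\mathbb{C}^{r+1})$, with character $\chi_{(2s)}(x)$ the complete homogeneous symmetric polynomial of degree $2s$ in $x_1,\dots,x_{r+1}$. The $\mu_\lambda$ are equivalently defined by $[\chi_{(2s)}(x)]^L=\sum_\lambda\mu_\lambda\chi_\lambda(x)$,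 the sum being over partitions $\lambda$ of $2sL$ with at most $r+1$ parts. The integers $c_{s,L}(\vec M)$ are defined by $$[\chi_{(2s)}(x)]^L=\sum_{0\le M_r\le\dots\le M_1\le 2sL}c_{s,L}(\vec M)\,x_1^{2sL-M_1}x_2^{M_1-M_2}\cdots x_r^{M_{r-1}-M_r}x_{r+1}^{M_r},$$ and $c_{s,L}(\vec M)=0$ for $\vec M\in\mathbb{Z}^r$ outside the range of summation. Shift operator: for a polynomial $P(t_1,\dots,t_r)=\sum_\beta p_\beta t_1^{\beta_1}\cdots t_r^{\beta_r}$ and a function $f$ on $\mathbb{Z}^r$, $\mathcal{D}_{P}f(M_1,\dots,M_r)=\sum_\beta p_\beta f(M_1-\beta_1,\dots,M_r-\beta_r)$. Weyl denominator: $R_{A_r}(t)=\prod_{\alpha\in\Phi^+}(1-t^\alpha)$, where $\Phi^+$ is the set of positive roots of $A_r$ and $t^\alpha=t_1^{n_1}\cdots t_r^{n_r}$ for $\alpha=\sum_i n_i\alpha_i$ with simple roots $\alpha_i=L_i-L_{i+1}$. Explicitly, $R_{A_r}(t)=\prod_{1\le a<b\le r+1}(1-t_at_{a+1}\cdots t_{b-1})$. *)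

theory Defs
  imports Complex_Main "HOL-Library.Poly_Mapping" "HOL-Library.FuncSet"
begin

text \<open>Polynomials with integer coefficients in variables numbered by \<^typ>\<open>nat\<close>.  The characters of
  \<open>A\<^sub>r = sl(r+1)\<close> use the variables \<open>x\<^sub>1, \<dots>, x\<^sub>r\<^sub>+\<^sub>1\<close>, the Weyl denominator uses \<open>t\<^sub>1, \<dots>, t\<^sub>r\<close>.\<close>

type_synonym mpoly_int = "(nat \<Rightarrow>\<^sub>0 nat) \<Rightarrow>\<^sub>0 int"

definition var :: "nat \<Rightarrow> mpoly_int" where
  "var i = Poly_Mapping.single (Poly_Mapping.single i 1) 1"

text \<open>Partitions of \<open>m\<close> with at most \<open>n\<close> parts, as functions on the indices \<open>1, \<dots>, n\<close> padded with
  zeros: requiring the value zero elsewhere makes the representing function unique.\<close>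

definition partitions :: "nat \<Rightarrow> nat \<Rightarrow> (nat \<Rightarrow> nat) set" where
  "partitions n m = {lam. (\<forall>i. i \<notin> {1..n} \<longrightarrow> lam i = 0) \<and>
     (\<forall>i\<in>{1..n}. \<forall>j\<in>{1..n}. i \<le> j \<longrightarrow> lam j \<le> lam i) \<and> (\<Sum>i=1..n. lam i) = m}"

definition one_row :: "nat \<Rightarrow> nat \<Rightarrow> nat" where
  "one_row k = (\<lambda>i. if i = 1 then k else 0)"

definition diagram :: "nat \<Rightarrow> (nat \<Rightarrow> nat) \<Rightarrow> (nat \<times> nat) set" where
  "diagram n lam = {(i, j). i \<in> {1..n} \<and> j \<in> {1..lam i}}"

definition semistandard_tableaux :: "nat \<Rightarrow> (nat \<Rightarrow> nat) \<Rightarrow> (nat \<times> nat \<Rightarrow> nat) set" where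
  "semistandard_tableaux n lam = {T \<in> diagram n lam \<rightarrow>\<^sub>E {1..n}.
     (\<forall>i j. (i, j) \<in> diagram n lam \<longrightarrow> (i, Suc j) \<in> diagram n lam \<longrightarrow> T (i, j) \<le> T (i, Suc j)) \<and>
     (\<forall>i j. (i, j) \<in> diagram n lam \<longrightarrow> (Suc i, j) \<in> diagram n lam \<longrightarrow> T (i, j) < T (Suc i, j))}"

text \<open>The Schur polynomial in \<open>x\<^sub>1, \<dots>, x\<^sub>n\<close>, which is the character of the irreducible representation
  \<open>V\<^sub>\<lambda>\<close> of \<open>sl(n)\<close>.  It is an honest polynomial: the relation \<open>x\<^sub>1 \<cdots> x\<^sub>n = 1\<close> is not imposed, so
  that different partitions have different characters.  For a single row of length \<open>k\<close> the tableaux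
  are the weakly increasing words of length \<open>k\<close>, so this is the complete homogeneous symmetric
  polynomial, the character of \<open>Sym\<^sup>k\<close> of the standard representation.\<close>

definition schur_poly :: "nat \<Rightarrow> (nat \<Rightarrow> nat) \<Rightarrow> mpoly_int" where
  "schur_poly n lam = (\<Sum>T\<in>semistandard_tableaux n lam. \<Prod>b\<in>diagram n lam. var (T b))"

text \<open>The spin \<open>s\<close> enters only through the natural number \<open>k = 2s\<close>.  The following is the
  character of the tensor power \<open>V\<^sub>(\<^sub>2\<^sub>s\<^sub>)\<^sup>\<otimes>\<^sup>L\<close>.\<close>

definition tensor_power_char :: "nat \<Rightarrow> nat \<Rightarrow> nat \<Rightarrow> mpoly_int" where
  "tensor_power_char r k L = schur_poly (r + 1) (one_row k) ^ L"

text \<open>The multiplicities \<open>\<mu>\<^sub>\<lambda>\<close> of the \<open>V\<^sub>\<lambda>\<close> in the tensor power: the unique coefficients in the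
  decomposition of its character into irreducible characters, over the partitions of \<open>2sL\<close> with at
  most \<open>r + 1\<close> parts.  (The first clause normalizes the values at arguments that are not such
  partitions.)\<close>

definition multiplicity_in_tensor_power :: "nat \<Rightarrow> nat \<Rightarrow> nat \<Rightarrow> (nat \<Rightarrow> nat) \<Rightarrow> int" where
  "multiplicity_in_tensor_power r k L = (THE mu.
     (\<forall>lam. lam \<notin> partitions (r + 1) (k * L) \<longrightarrow> mu lam = 0) \<and>
     tensor_power_char r k L =
       (\<Sum>lam\<in>partitions (r + 1) (k * L). of_int (mu lam) * schur_poly (r + 1) lam))"

text \<open>Elements of \<open>\<int>\<^sup>r\<close> are functions of which only the values at \<open>1, \<dots>, r\<close> matter;
  the next function imposes the boundary conventions \<open>M\<^sub>0 = N\<close> and \<open>M\<^sub>r\<^sub>+\<^sub>1 = 0\<close>.\<close>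

definition with_boundary :: "nat \<Rightarrow> int \<Rightarrow> (nat \<Rightarrow> int) \<Rightarrow> nat \<Rightarrow> int" where
  "with_boundary r N M = M(0 := N, r + 1 := 0)"

text \<open>\<open>c\<^sub>s\<^sub>,\<^sub>L(M)\<close> is the coefficient of \<open>\<Prod>\<^sub>i x\<^sub>i\<close> to the power \<open>M\<^sub>i\<^sub>-\<^sub>1 - M\<^sub>i\<close> (\<open>i = 1, \<dots>, r + 1\<close>) if
  \<open>0 \<le> M\<^sub>r \<le> \<dots> \<le> M\<^sub>1 \<le> 2sL\<close>, and zero otherwise.\<close>

definition weight_coeff :: "nat \<Rightarrow> nat \<Rightarrow> nat \<Rightarrow> (nat \<Rightarrow> int) \<Rightarrow> int" where
  "weight_coeff r k L M = (let B = with_boundary r (int (k * L)) M in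
     if \<forall>i\<in>{1..r+1}. B i \<le> B (i - 1)
     then Poly_Mapping.lookup (tensor_power_char r k L)
            (\<Sum>i=1..r+1. Poly_Mapping.single i (nat (B (i - 1) - B i)))
     else 0)"

definition shift_op :: "mpoly_int \<Rightarrow> ((nat \<Rightarrow> int) \<Rightarrow> int) \<Rightarrow> (nat \<Rightarrow> int) \<Rightarrow> int" where
  "shift_op P f M = (\<Sum>\<beta>\<in>Poly_Mapping.keys P.
     Poly_Mapping.lookup P \<beta> * f (\<lambda>i. M i - int (Poly_Mapping.lookup \<beta> i)))"

text \<open>The positive roots of \<open>A\<^sub>r\<close> are \<open>L\<^sub>a - L\<^sub>b\<close>, the sum of the simple roots numbered from \<open>a\<close>
  to \<open>b - 1\<close>, for \<open>1 \<le> a < b \<le> r + 1\<close>.\<close>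

definition weyl_denominator :: "nat \<Rightarrow> mpoly_int" where
  "weyl_denominator r = (\<Prod>(a, b)\<in>{(a, b). 1 \<le> a \<and> a < b \<and> b \<le> r + 1}. 1 - (\<Prod>i\<in>{a..<b}. var i))"

end

theory Submission
  imports Defs "HOL-Library.Infinite_Set" "Jordan_Normal_Form.Determinant"
begin

text \<open>Write \<open>n = r + 1\<close>, \<open>\<delta> = (n - 1, \<dots>, 1, 0)\<close>, \<open>a\<^sub>l = det (x\<^sub>j ^ l\<^sub>i)\<close>, and \<open>V\<close> for the product of the
  \<open>x\<^sub>a - x\<^sub>b\<close>, \<open>a < b\<close>.  With \<open>t\<^sub>i = x\<^sub>i\<^sub>+\<^sub>1 / x\<^sub>i\<close> the Weyl denominator is \<open>x\<^sup>-\<^sup>\<delta> V\<close>, so the right-hand side is the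
  coefficient of \<open>x\<^sup>\<lambda>\<^sup>+\<^sup>\<delta>\<close> in \<open>V h\<^sup>L\<close>, where \<open>h\<close> is the character of \<open>V\<^sub>(\<^sub>2\<^sub>s\<^sub>)\<close>.  The bialternant formula
  \<open>V \<chi>\<^sub>\<nu> = a\<^sub>\<nu>\<^sub>+\<^sub>\<delta>\<close> follows by induction on the number of variables: removing the last variable,
  both sides branch over the same interlacing partitions.  The coefficient of \<open>x\<^sup>\<lambda>\<^sup>+\<^sup>\<delta>\<close> in \<open>a\<^sub>\<nu>\<^sub>+\<^sub>\<delta>\<close> is \<open>1\<close>
  if \<open>\<nu> = \<lambda>\<close> and \<open>0\<close> otherwise, so it reads off multiplicities.  That \<open>h\<^sup>L\<close> is an integral combination of
  Schur polynomials at all holds because multiplying an alternant by the symmetric polynomial \<open>h\<close>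
  gives a sum of alternants, and every alternant is zero or plus or minus some \<open>a\<^sub>\<nu>\<^sub>+\<^sub>\<delta>\<close>.\<close>

subsection \<open>Alternants\<close>

definition alternant :: "nat \<Rightarrow> (nat \<Rightarrow> nat) \<Rightarrow> (nat \<Rightarrow> 'a::comm_ring_1) \<Rightarrow> 'a" where
  "alternant n l x = det (mat n n (\<lambda>(i, j). x j ^ l i))"

lemma alternant_Leibniz:
  "alternant n l x = (\<Sum>p | p permutes {0..<n}. signof p * (\<Prod>i<n. x (p i) ^ l i))"
proof -
  have "(\<Prod>i = 0..<n. mat n n (\<lambda>(i, j). x j ^ l i) $$ (i, p i)) = (\<Prod>i<n. x (p i) ^ l i)"
    if "p permutes {0..<n}" for p
    unfolding atLeast0LessThan
    using permutes_in_image[OF that] by (intro prod.cong) auto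
  then show ?thesis
    unfolding alternant_def by (subst det_def'[of _ n]) auto
qed

lemma alternant_cong:
  assumes "\<And>i. i < n \<Longrightarrow> l i = l' i"
  shows "alternant n l x = alternant n l' x"
  unfolding alternant_Leibniz using assms by simp

lemma alternant_permute_exponents:
  assumes "p permutes {0..<n}"
  shows "alternant n (l \<circ> p) x = signof p * alternant n l x"
proof -
  have eq: "mat n n (\<lambda>(i, j). x j ^ (l \<circ> p) i) =
      mat n n (\<lambda>(i, j). mat n n (\<lambda>(i, j). x j ^ l i) $$ (p i, j))"
    using permutes_in_image[OF assms] by (intro eq_matI) auto
  show ?thesis
    unfolding alternant_def eq by (rule det_permute_rows[OF mat_carrier assms])
qed

lemma alternant_permute_variables:
  assumes p: "p permutes {0..<n}"
  shows "alternant n l (x \<circ> p) = signof p * alternant n l x"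
proof -
  \<comment> \<open>\<open>det_permute_rows\<close> acts on rows, while the variables index the
    columns; hence the transpose.\<close>
  have tr: "alternant n l y = det (mat n n (\<lambda>(i, j). y i ^ l j))" for y :: "nat \<Rightarrow> 'a"
    unfolding alternant_def
    by (subst det_transpose[symmetric, of _ n]) (auto intro!: arg_cong[of _ _ det] eq_matI)
  have eq: "mat n n (\<lambda>(i, j). (x \<circ> p) i ^ l j) =
      mat n n (\<lambda>(i, j). mat n n (\<lambda>(i, j). x i ^ l j) $$ (p i, j))"
    using permutes_in_image[OF p] by (intro eq_matI) auto
  show ?thesis
    unfolding tr eq by (rule det_permute_rows[OF mat_carrier p])
qed

lemma alternant_repeated_exponent:
  assumes "i < n" "j < n" "i \<noteq> j" "l i = l j"
  shows "alternant n l x = 0"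
  unfolding alternant_def
  using assms by (intro det_identical_rows[of _ n i j]) (auto simp: row_def)

text \<open>Multilinearity of the determinant: a factor common to a column comes out, and
  \<open>f\<close> selects one monomial from every row.\<close>

lemma alternant_sum_rows:
  fixes S :: "nat \<Rightarrow> nat set"
  assumes "\<And>i. i < n \<Longrightarrow> finite (S i)"
  shows "det (mat n n (\<lambda>(i, j). c j * (\<Sum>m\<in>S i. g i m * x j ^ m))) =
    (\<Prod>j<n. c j) * (\<Sum>f\<in>Pi\<^sub>E {..<n} S. (\<Prod>i<n. g i (f i)) * alternant n f x)"
proof -
  let ?P = "{p. p permutes {0..<n}}"
  have "det (mat n n (\<lambda>(i, j). c j * (\<Sum>m\<in>S i. g i m * x j ^ m))) =
      (\<Sum>p\<in>?P. signof p * (\<Prod>i<n. c (p i) * (\<Sum>m\<in>S i. g i m * x (p i) ^ m)))"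
  proof (subst det_def'[of _ n], simp, rule sum.cong[OF refl])
    fix p assume "p \<in> ?P"
    then have p: "p permutes {..<n}" by (simp add: atLeast0LessThan)
    have "(\<Prod>i = 0..<n. mat n n (\<lambda>(i, j). c j * (\<Sum>m\<in>S i. g i m * x j ^ m)) $$ (i, p i))
        = (\<Prod>i<n. c (p i) * (\<Sum>m\<in>S i. g i m * x (p i) ^ m))"
      unfolding atLeast0LessThan using permutes_in_image[OF p] by (intro prod.cong) auto
    then show "signof p * (\<Prod>i = 0..<n. mat n n (\<lambda>(i, j). c j * (\<Sum>m\<in>S i. g i m * x j ^ m)) $$ (i, p i))
        = signof p * (\<Prod>i<n. c (p i) * (\<Sum>m\<in>S i. g i m * x (p i) ^ m))" by simp
  qed
  also have "\<dots> = (\<Sum>p\<in>?P. \<Sum>f\<in>Pi\<^sub>E {..<n} S.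
      (\<Prod>j<n. c j) * ((\<Prod>i<n. g i (f i)) * (signof p * (\<Prod>i<n. x (p i) ^ f i))))"
  proof (rule sum.cong[OF refl])
    fix p assume "p \<in> ?P"
    then have p: "p permutes {..<n}" by (simp add: atLeast0LessThan)
    have "(\<Prod>i<n. c (p i)) = (\<Prod>j<n. c j)"
      using prod.permute[OF p, of c] by (simp add: o_def)
    moreover have "(\<Prod>i<n. \<Sum>m\<in>S i. g i m * x (p i) ^ m) =
        (\<Sum>f\<in>Pi\<^sub>E {..<n} S. (\<Prod>i<n. g i (f i) * x (p i) ^ f i))"
      using assms by (intro prod_sum_PiE) auto
    ultimately have "(\<Prod>i<n. c (p i) * (\<Sum>m\<in>S i. g i m * x (p i) ^ m)) =
        (\<Prod>j<n. c j) * (\<Sum>f\<in>Pi\<^sub>E {..<n} S. (\<Prod>i<n. g i (f i) * x (p i) ^ f i))"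
      by (simp only: prod.distrib)
    then show "signof p * (\<Prod>i<n. c (p i) * (\<Sum>m\<in>S i. g i m * x (p i) ^ m)) =
      (\<Sum>f\<in>Pi\<^sub>E {..<n} S. (\<Prod>j<n. c j) *
        ((\<Prod>i<n. g i (f i)) * (signof p * (\<Prod>i<n. x (p i) ^ f i))))"
      by (simp add: prod.distrib sum_distrib_left mult_ac)
  qed
  also have "\<dots> = (\<Prod>j<n. c j) * (\<Sum>f\<in>Pi\<^sub>E {..<n} S. (\<Prod>i<n. g i (f i)) * alternant n f x)"
    unfolding alternant_Leibniz sum_distrib_left by (rule sum.swap)
  finally show ?thesis .
qed

lemma power_diff_geometric:
  fixes a b :: "'a::comm_ring_1"
  assumes "p < q"
  shows "a ^ q - b ^ (q - p) * a ^ p = (a - b) * (\<Sum>m\<in>{p..<q}. b ^ (q - 1 - m) * a ^ m)"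
proof -
  have "a ^ q - b ^ (q - p) * a ^ p = a ^ p * (a ^ (q - p) - b ^ (q - p))"
    using assms by (simp add: algebra_simps flip: power_add)
  also have "a ^ (q - p) - b ^ (q - p) = (a - b) * (\<Sum>i<q - p. b ^ (q - p - Suc i) * a ^ i)"
    by (rule power_diff_sumr2)
  also have "a ^ p * \<dots> = (a - b) * (\<Sum>i<q - p. b ^ (q - p - Suc i) * a ^ (i + p))"
    by (simp add: sum_distrib_left power_add mult_ac)
  also have "(\<Sum>i<q - p. b ^ (q - p - Suc i) * a ^ (i + p)) = (\<Sum>m\<in>{p..<q}. b ^ (q - 1 - m) * a ^ m)"
    by (rule sum.reindex_bij_witness[of _ "\<lambda>m. m - p" "\<lambda>i. i + p"]) (use assms in \<open>auto simp: algebra_simps\<close>)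
  finally show ?thesis .
qed

text \<open>Subtracting from every row a multiple of the next one clears the last column and makes
  \<open>x\<^sub>j - x\<^sub>n\<close> a factor of column \<open>j\<close>; the quotient expands over all interlacing exponents.\<close>

lemma alternant_Suc:
  assumes dec: "\<And>i. i < n \<Longrightarrow> l (Suc i) < l i"
  shows "alternant (Suc n) l x = (\<Prod>j<n. x j - x n) *
    (\<Sum>f\<in>(\<Pi>\<^sub>E i\<in>{..<n}. {l (Suc i)..<l i}). x n ^ (l n + (\<Sum>i<n. l i - 1 - f i)) * alternant n f x)"
proof -
  define A where "A = mat (Suc n) (Suc n) (\<lambda>(i, j). x j ^ l i)"
  \<comment> \<open>Unitriangular, hence of determinant 1. The superdiagonal entry is chosen so that
    row \<open>i < n\<close> of \<open>U * A\<close> vanishes in column \<open>n\<close>.\<close>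
  define U where "U = mat (Suc n) (Suc n) (\<lambda>(i, j).
    if j = i then 1 else if j = Suc i then - (x n ^ (l i - l (Suc i))) else 0)"
  define B where "B = mat (Suc n) (Suc n) (\<lambda>(i, j).
    if i < n then x j ^ l i - x n ^ (l i - l (Suc i)) * x j ^ l (Suc i) else x j ^ l i)"
  have carr: "A \<in> carrier_mat (Suc n) (Suc n)" "U \<in> carrier_mat (Suc n) (Suc n)"
    "B \<in> carrier_mat (Suc n) (Suc n)"
    by (auto simp: A_def U_def B_def)
  have "B = U * A"
  proof (rule eq_matI)
    fix i j assume "i < dim_row (U * A)" "j < dim_col (U * A)"
    then have i: "i < Suc n" and j: "j < Suc n" using carr by auto
    have "(U * A) $$ (i, j) = (\<Sum>k = 0..<Suc n. U $$ (i, k) * A $$ (k, j))"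
      using i j carr by (auto simp: scalar_prod_def row_def col_def)
    also have "\<dots> = (\<Sum>k\<in>{i, Suc i} \<inter> {0..<Suc n}. U $$ (i, k) * A $$ (k, j))"
      using i by (intro sum.mono_neutral_right) (auto simp: U_def)
    also have "\<dots> = B $$ (i, j)"
    proof (cases "i < n")
      case True
      then have "{i, Suc i} \<inter> {0..<Suc n} = {i, Suc i}" by auto
      then show ?thesis using True i j by (simp add: U_def A_def B_def)
    next
      case False
      then have "{i, Suc i} \<inter> {0..<Suc n} = {i}" using i by auto
      then show ?thesis using False i j by (simp add: U_def A_def B_def)
    qed
    finally show "B $$ (i, j) = (U * A) $$ (i, j)" by simp
  qed (use carr in auto)
  moreover have "det U = 1"
  proof -
    have "upper_triangular U" by (auto simp: U_def)
    moreover have "diag_mat U = map (\<lambda>_. 1) [0..<Suc n]"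
      unfolding diag_mat_def by (rule map_cong) (auto simp: U_def)
    ultimately have "det U = prod_list (map (\<lambda>_. 1) [0..<Suc n])"
      using det_upper_triangular[OF _ carr(2)] by simp
    then show ?thesis by (simp add: map_replicate_const)
  qed
  ultimately have "det A = det B"
    using det_mult[OF carr(2,1)] by simp
  also have "det B = (\<Sum>i<Suc n. B $$ (i, n) * cofactor B i n)"
    using carr by (intro laplace_expansion_column) auto
  also have "\<dots> = (\<Sum>i\<in>{n}. B $$ (i, n) * cofactor B i n)"
  proof (rule sum.mono_neutral_right)
    show "\<forall>i\<in>{..<Suc n} - {n}. B $$ (i, n) * cofactor B i n = 0"
    proof
      fix i assume "i \<in> {..<Suc n} - {n}"
      then have i: "i < n" by auto
      then have "B $$ (i, n) = 0"
        using dec[OF i] by (simp add: B_def flip: power_add)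
      then show "B $$ (i, n) * cofactor B i n = 0" by simp
    qed
  qed auto
  \<comment> \<open>Only the corner entry of the last column survives, and its cofactor sign is an
    even power of -1.\<close>
  also have "\<dots> = x n ^ l n * det (mat_delete B n n)"
    by (simp add: cofactor_def B_def flip: mult_2 power_mult)
  also have "mat_delete B n n = mat n n (\<lambda>(i, j). (x j - x n) *
      (\<Sum>m\<in>{l (Suc i)..<l i}. x n ^ (l i - 1 - m) * x j ^ m))"
    unfolding mat_delete_def
    using dec by (intro eq_matI) (auto simp: B_def power_diff_geometric)
  also have "x n ^ l n * det \<dots> = (\<Prod>j<n. x j - x n) *
    (\<Sum>f\<in>(\<Pi>\<^sub>E i\<in>{..<n}. {l (Suc i)..<l i}). x n ^ (l n + (\<Sum>i<n. l i - 1 - f i)) * alternant n f x)"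
    by (subst alternant_sum_rows) (auto simp: power_add power_sum sum_distrib_left mult_ac)
  finally show ?thesis
    by (simp add: A_def alternant_def)
qed

subsection \<open>Branching of Schur polynomials\<close>

text \<open>The variables are numbered from \<open>0\<close> here, to match the determinants.\<close>

definition schur :: "nat \<Rightarrow> (nat \<Rightarrow> nat) \<Rightarrow> (nat \<Rightarrow> 'a::comm_ring_1) \<Rightarrow> 'a" where
  "schur n lam x = (\<Sum>T\<in>semistandard_tableaux n lam. \<Prod>b\<in>diagram n lam. x (T b - 1))"

lemma diagram_Sigma: "diagram n lam = (SIGMA i:{1..n}. {1..lam i})"
  by (auto simp: diagram_def)

lemma finite_diagram [simp]: "finite (diagram n lam)"
  by (simp add: diagram_Sigma)

lemma card_diagram: "card (diagram n lam) = (\<Sum>i=1..n. lam i)"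
  by (simp add: diagram_Sigma)

lemma finite_semistandard_tableaux [simp]: "finite (semistandard_tableaux n lam)"
  by (rule finite_subset[of _ "diagram n lam \<rightarrow>\<^sub>E {1..n}"])
    (auto simp: semistandard_tableaux_def intro: finite_PiE)

lemma semistandard_tableaux_range:
  "T \<in> semistandard_tableaux n lam \<Longrightarrow> b \<in> diagram n lam \<Longrightarrow> T b \<in> {1..n}"
  by (auto simp: semistandard_tableaux_def)

lemma semistandard_tableaux_row:
  assumes "T \<in> semistandard_tableaux n lam" "(i, j') \<in> diagram n lam" "1 \<le> j" "j \<le> j'"
  shows "T (i, j) \<le> T (i, j')"
  using assms(4,2)
proof (induction rule: dec_induct)
  case (step m)
  then have "(i, m) \<in> diagram n lam" using assms(3) by (auto simp: diagram_def)
  then have "T (i, j) \<le> T (i, m)" "T (i, m) \<le> T (i, Suc m)"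
    using step assms(1) by (auto simp: semistandard_tableaux_def)
  then show ?case by (rule le_trans)
qed simp

text \<open>Entries start at 1 or more and strictly increase down a column. In
  \<open>schur_Suc\<close> this makes the bottom row constant, equal to the largest entry.\<close>

lemma semistandard_tableaux_ge_row_index:
  assumes T: "T \<in> semistandard_tableaux n lam" and dec: "antimono_on {1..n} lam"
    and "(i, j) \<in> diagram n lam"
  shows "i \<le> T (i, j)"
  using assms(3)
proof (induction i)
  case (Suc i)
  show ?case
  proof (cases "i = 0")
    case True
    then show ?thesis using semistandard_tableaux_range[OF T Suc.prems] by simp
  next
    case False
    then have "lam (Suc i) \<le> lam i"
      using Suc.prems by (intro monotone_onD[OF dec]) (auto simp: diagram_def)
    then have "(i, j) \<in> diagram n lam"
      using Suc.prems False by (auto simp: diagram_def)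
    then have "i \<le> T (i, j)" "T (i, j) < T (Suc i, j)"
      using Suc T by (auto simp: semistandard_tableaux_def)
    then show ?thesis by simp
  qed
qed simp

text \<open>Rows increase weakly, so the columns holding entries at most \<open>n\<close> form such
  a set; counting them then determines them.\<close>

lemma downward_closed_eq_atLeastAtMost_card:
  fixes A :: "nat set"
  assumes "finite A" "\<And>j. j \<in> A \<Longrightarrow> 1 \<le> j" "\<And>i j. j \<in> A \<Longrightarrow> 1 \<le> i \<Longrightarrow> i \<le> j \<Longrightarrow> i \<in> A"
  shows "A = {1..card A}"
proof (cases "A = {}")
  case False
  have "A = {1..Max A}"
  proof (intro subset_antisym subsetI)
    fix j assume "j \<in> A"
    then show "j \<in> {1..Max A}" using assms(1,2) by simp
  next
    fix j assume "j \<in> {1..Max A}"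
    then show "j \<in> A" using assms(3)[OF Max_in[OF assms(1) False], of j] by simp
  qed
  then obtain m where "A = {1..m}" by blast
  then show ?thesis by simp
qed simp

text \<open>A tableau with entries up to \<open>n + 1\<close> is a tableau with entries up to \<open>n\<close> whose shape
  interlaces with \<open>lam\<close>, filled up with entries \<open>n + 1\<close>.\<close>

lemma schur_Suc:
  fixes lam :: "nat \<Rightarrow> nat" and x :: "nat \<Rightarrow> 'a::comm_ring_1"
  assumes dec: "antimono_on {1..Suc n} lam"
  shows "schur (Suc n) lam x = (\<Sum>nu\<in>(\<Pi>\<^sub>E i\<in>{1..n}. {lam (Suc i)..lam i}).
    x n ^ (lam (Suc n) + (\<Sum>i=1..n. lam i - nu i)) * schur n nu x)"
proof -
  let ?D = "diagram (Suc n) lam"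
  let ?I = "\<Pi>\<^sub>E i\<in>{1..n}. {lam (Suc i)..lam i}"
  \<comment> \<open>\<open>sh T\<close> is the shape left after deleting the entries
    \<open>Suc n\<close>; \<open>ext\<close> puts them back. Both take the value
    \<open>undefined\<close> off their domains, as the extensional function spaces require.\<close>
  define sh where "sh T = (\<lambda>i\<in>{1..n}. card {j\<in>{1..lam i}. T (i, j) \<le> n})" for T :: "nat \<times> nat \<Rightarrow> nat"
  define ext where "ext nu T b = (if b \<in> diagram n nu then T b else if b \<in> ?D then Suc n else undefined)"
    for nu and T :: "nat \<times> nat \<Rightarrow> nat" and b
  have sub: "diagram n nu \<subseteq> ?D" if "nu \<in> ?I" for nu
  proof -
    have "nu i \<le> lam i" if "i \<in> {1..n}" for i using \<open>nu \<in> ?I\<close> that by (auto simp: PiE_iff)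
    then show ?thesis by (force simp: diagram_def)
  qed
  have sh_row: "{j\<in>{1..lam i}. T (i, j) \<le> n} = {1..sh T i}"
    if T: "T \<in> semistandard_tableaux (Suc n) lam" and i: "i \<in> {1..n}" for T i
  proof -
    have "{j\<in>{1..lam i}. T (i, j) \<le> n} = {1..card {j\<in>{1..lam i}. T (i, j) \<le> n}}"
    proof (rule downward_closed_eq_atLeastAtMost_card)
      fix j' j assume j: "j \<in> {j\<in>{1..lam i}. T (i, j) \<le> n}" "1 \<le> j'" "j' \<le> j"
      then have "T (i, j') \<le> T (i, j)"
        using i by (intro semistandard_tableaux_row[OF T]) (auto simp: diagram_def)
      then show "j' \<in> {j\<in>{1..lam i}. T (i, j) \<le> n}" using j by auto
    qed auto
    then show ?thesis using i by (simp add: sh_def)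
  qed
  have sh_mem: "b \<in> diagram n (sh T) \<longleftrightarrow> T b \<le> n"
    if T: "T \<in> semistandard_tableaux (Suc n) lam" and b: "b \<in> ?D" for T b
  proof -
    obtain i j where ij: "b = (i, j)" "i \<in> {1..Suc n}" "j \<in> {1..lam i}"
      using b by (auto simp: diagram_def)
    show ?thesis
    proof (cases "i = Suc n")
      \<comment> \<open>Entries of row \<open>Suc n\<close> are at least \<open>Suc n\<close>, so
        both sides of the equivalence are false.\<close>
      case True
      then show ?thesis
        using semistandard_tableaux_ge_row_index[OF T dec, of i j] b ij by (auto simp: diagram_def)
    next
      case False
      then have i: "i \<in> {1..n}" using ij by auto
      have "T b \<le> n \<longleftrightarrow> j \<in> {j\<in>{1..lam i}. T (i, j) \<le> n}" using ij by simp
      also have "\<dots> \<longleftrightarrow> j \<in> {1..sh T i}" by (simp only: sh_row[OF T i])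
      also have "\<dots> \<longleftrightarrow> b \<in> diagram n (sh T)" using ij i by (simp add: diagram_def)
      finally show ?thesis by simp
    qed
  qed
  have sh_in: "sh T \<in> ?I" if T: "T \<in> semistandard_tableaux (Suc n) lam" for T
  proof -
    have "lam (Suc i) \<le> sh T i \<and> sh T i \<le> lam i" if i: "i \<in> {1..n}" for i
    proof -
      have le: "lam (Suc i) \<le> lam i" using i by (intro monotone_onD[OF dec]) auto
      \<comment> \<open>A cell with another cell beneath it has an entry below \<open>Suc n\<close>,
        which gives the lower interlacing bound.\<close>
      have "{1..lam (Suc i)} \<subseteq> {j\<in>{1..lam i}. T (i, j) \<le> n}"
      proof
        fix j assume j: "j \<in> {1..lam (Suc i)}"
        then have D: "(i, j) \<in> ?D" "(Suc i, j) \<in> ?D" using i le by (auto simp: diagram_def)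
        then have "T (i, j) < T (Suc i, j)" using T by (auto simp: semistandard_tableaux_def)
        then have "T (i, j) \<le> n" using semistandard_tableaux_range[OF T D(2)] by auto
        then show "j \<in> {j\<in>{1..lam i}. T (i, j) \<le> n}" using j le by auto
      qed
      then have "card {1..lam (Suc i)} \<le> card {1..sh T i}"
        unfolding sh_row[OF T i] by (intro card_mono) auto
      moreover have "card {1..sh T i} \<le> card {1..lam i}"
        unfolding sh_row[OF T i, symmetric] by (intro card_mono) auto
      ultimately show ?thesis by simp
    qed
    then show ?thesis by (auto simp: PiE_iff sh_def)
  qed
  have res: "restrict T (diagram n (sh T)) \<in> semistandard_tableaux n (sh T)"
    if T: "T \<in> semistandard_tableaux (Suc n) lam" for T
  proof -
    have "T b \<in> {1..n}" if "b \<in> diagram n (sh T)" for b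
      using that semistandard_tableaux_range[OF T, of b] sh_mem[OF T, of b] sub[OF sh_in[OF T]] by auto
    then show ?thesis
      using T sub[OF sh_in[OF T]] by (auto simp: semistandard_tableaux_def subset_iff)
  qed
  have ext_in: "ext nu T \<in> semistandard_tableaux (Suc n) lam"
    if nu: "nu \<in> ?I" and T: "T \<in> semistandard_tableaux n nu" for nu T
  proof -
    have le: "T b \<le> n" "1 \<le> T b" if "b \<in> diagram n nu" for b
      using semistandard_tableaux_range[OF T that] by auto
    have int: "lam (Suc i) \<le> nu i \<and> nu i \<le> lam i" if "i \<in> {1..n}" for i
      using nu that by (auto simp: PiE_iff)
    have "ext nu T \<in> ?D \<rightarrow>\<^sub>E {1..Suc n}"
      using le sub[OF nu] by (fastforce simp: ext_def PiE_iff extensional_def)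
    moreover have "ext nu T (i, j) \<le> ext nu T (i, Suc j)"
      if "(i, j) \<in> ?D" "(i, Suc j) \<in> ?D" for i j
    proof (cases "(i, Suc j) \<in> diagram n nu")
      case True
      then have D: "(i, j) \<in> diagram n nu" using that by (auto simp: diagram_def)
      then have "T (i, j) \<le> T (i, Suc j)" using T True by (auto simp: semistandard_tableaux_def)
      then show ?thesis using D True by (simp add: ext_def)
    next
      case False
      then show ?thesis using that le[of "(i, j)"] by (auto simp: ext_def)
    qed
    moreover have "ext nu T (i, j) < ext nu T (Suc i, j)"
      if "(i, j) \<in> ?D" "(Suc i, j) \<in> ?D" for i j
    proof -
      have "i \<in> {1..n}" using that by (auto simp: diagram_def)
      \<comment> \<open>The bound \<open>lam (Suc i) \<le> nu i\<close> prevents two new entries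
        \<open>Suc n\<close> from standing in one column.\<close>
      then have D: "(i, j) \<in> diagram n nu"
        using that int[of i] by (auto simp: diagram_def)
      show ?thesis
      proof (cases "(Suc i, j) \<in> diagram n nu")
        case True
        then have "T (i, j) < T (Suc i, j)" using T D by (auto simp: semistandard_tableaux_def)
        then show ?thesis using D True by (simp add: ext_def)
      next
        case False
        then show ?thesis using that D le[OF D] by (auto simp: ext_def)
      qed
    qed
    ultimately show ?thesis by (auto simp: semistandard_tableaux_def)
  qed
  have sh_ext: "sh (ext nu T) = nu"
    if nu: "nu \<in> ?I" and T: "T \<in> semistandard_tableaux n nu" for nu T
  proof
    fix i
    show "sh (ext nu T) i = nu i"
    proof (cases "i \<in> {1..n}")
      case True
      then have "nu i \<le> lam i" using nu by (auto simp: PiE_iff)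
      then have "ext nu T (i, j) \<le> n \<longleftrightarrow> j \<le> nu i" if "j \<in> {1..lam i}" for j
        using that True semistandard_tableaux_range[OF T, of "(i, j)"]
        by (auto simp: ext_def diagram_def)
      then have "{j\<in>{1..lam i}. ext nu T (i, j) \<le> n} = {1..nu i}"
        using \<open>nu i \<le> lam i\<close> by auto
      then show ?thesis using True by (simp add: sh_def)
    next
      case False
      then show ?thesis using nu by (auto simp: sh_def PiE_iff extensional_def)
    qed
  qed
  have weight: "(\<Prod>b\<in>?D. x (T b - 1)) =
      x n ^ (lam (Suc n) + (\<Sum>i=1..n. lam i - sh T i)) * (\<Prod>b\<in>diagram n (sh T). x (T b - 1))"
    if T: "T \<in> semistandard_tableaux (Suc n) lam" for T
  proof -
    let ?D' = "diagram n (sh T)"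
    have "(\<Prod>b\<in>?D. x (T b - 1)) = (\<Prod>b\<in>?D - ?D'. x (T b - 1)) * (\<Prod>b\<in>?D'. x (T b - 1))"
      using sub[OF sh_in[OF T]] by (intro prod.subset_diff) auto
    also have "(\<Prod>b\<in>?D - ?D'. x (T b - 1)) = (\<Prod>b\<in>?D - ?D'. x n)"
    proof (rule prod.cong[OF refl])
      fix b assume "b \<in> ?D - ?D'"
      then have "T b = Suc n"
        using sh_mem[OF T, of b] semistandard_tableaux_range[OF T, of b] by auto
      then show "x (T b - 1) = x n" by simp
    qed
    also have "\<dots> = x n ^ (card ?D - card ?D')"
      using sub[OF sh_in[OF T]] by (simp add: card_Diff_subset)
    \<comment> \<open>The removed cells are the whole bottom row and \<open>lam i - sh T i\<close>
      cells in each other row.\<close>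
    also have "card ?D - card ?D' = lam (Suc n) + (\<Sum>i=1..n. lam i - sh T i)"
    proof -
      have le: "sh T i \<le> lam i" if "i \<in> {1..n}" for i
        using sh_in[OF T] that by (auto simp: PiE_iff)
      then have "(\<Sum>i=1..n. lam i - sh T i) = (\<Sum>i=1..n. lam i) - (\<Sum>i=1..n. sh T i)"
        by (intro sum_subtractf_nat) auto
      moreover have "(\<Sum>i=1..n. sh T i) \<le> (\<Sum>i=1..n. lam i)"
        using le by (intro sum_mono) auto
      ultimately show ?thesis by (simp add: card_diagram)
    qed
    finally show ?thesis .
  qed
  have "schur (Suc n) lam x = (\<Sum>(nu, T)\<in>(SIGMA nu:?I. semistandard_tableaux n nu).
      x n ^ (lam (Suc n) + (\<Sum>i=1..n. lam i - nu i)) * (\<Prod>b\<in>diagram n nu. x (T b - 1)))"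
    unfolding schur_def
  proof (rule sum.reindex_bij_witness[of _ "\<lambda>(nu, T). ext nu T"
        "\<lambda>T. (sh T, restrict T (diagram n (sh T)))"], goal_cases)
    case (1 T)
    have "ext (sh T) (restrict T (diagram n (sh T))) b = T b" for b
    proof (cases "b \<in> ?D")
      case True
      then show ?thesis
        using sh_mem[OF 1 True] semistandard_tableaux_range[OF 1 True] by (auto simp: ext_def)
    next
      case False
      moreover from this have "T b = undefined"
        using 1 by (intro PiE_arb[of T ?D]) (auto simp: semistandard_tableaux_def)
      ultimately show ?thesis
        using sub[OF sh_in[OF 1]] by (auto simp: ext_def)
    qed
    then show ?case by auto
  next
    case (2 T)
    then show ?case using sh_in res by auto
  next
    case (3 c)
    then obtain nu T where c: "c = (nu, T)" "nu \<in> ?I" "T \<in> semistandard_tableaux n nu"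
      by auto
    have "restrict (ext nu T) (diagram n nu) = T"
      using c(3) by (auto simp: fun_eq_iff restrict_def ext_def semistandard_tableaux_def
          PiE_iff extensional_def)
    then show ?case by (simp add: c(1) sh_ext[OF c(2,3)])
  next
    case (4 c)
    then show ?case using ext_in by auto
  next
    case (5 T)
    have "(\<Prod>b\<in>diagram n (sh T). x (restrict T (diagram n (sh T)) b - 1)) =
        (\<Prod>b\<in>diagram n (sh T). x (T b - 1))" by (rule prod.cong) auto
    then show ?case by (simp only: weight[OF 5] prod.case)
  qed
  also have "\<dots> = (\<Sum>nu\<in>?I. \<Sum>T\<in>semistandard_tableaux n nu.
      x n ^ (lam (Suc n) + (\<Sum>i=1..n. lam i - nu i)) * (\<Prod>b\<in>diagram n nu. x (T b - 1)))"
    by (subst sum.Sigma) (auto intro!: finite_PiE)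
  finally show ?thesis by (simp add: schur_def sum_distrib_left)
qed

subsection \<open>The bialternant formula\<close>

definition vandermonde :: "nat \<Rightarrow> (nat \<Rightarrow> 'a::comm_ring_1) \<Rightarrow> 'a" where
  "vandermonde n x = (\<Prod>(i, j)\<in>{(i, j). i < j \<and> j < n}. x i - x j)"

text \<open>The split is by whether the larger index is \<open>n\<close>; the new factor is the one
  that appears in \<open>alternant_Suc\<close>.\<close>

lemma vandermonde_Suc: "vandermonde (Suc n) x = (\<Prod>j<n. x j - x n) * vandermonde n x"
proof -
  have fin: "finite {(i, j). i < j \<and> j < n}"
    by (rule finite_subset[of _ "{..<n} \<times> {..<n}"]) auto
  have "{(i, j). i < j \<and> j < Suc n} = (\<lambda>i. (i, n)) ` {..<n} \<union> {(i, j). i < j \<and> j < n}"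
    by (auto simp: less_Suc_eq)
  then have "vandermonde (Suc n) x =
      (\<Prod>(i, j)\<in>(\<lambda>i. (i, n)) ` {..<n}. x i - x j) * vandermonde n x"
    unfolding vandermonde_def using fin by (simp only:) (intro prod.union_disjoint, auto)
  then show ?thesis
    by (simp add: prod.reindex inj_on_def)
qed

theorem bialternant_formula:
  fixes lam :: "nat \<Rightarrow> nat" and x :: "nat \<Rightarrow> 'a::comm_ring_1"
  assumes "antimono_on {1..n} lam"
  shows "vandermonde n x * schur n lam x = alternant n (\<lambda>i. lam (Suc i) + (n - Suc i)) x"
  using assms
proof (induction n arbitrary: lam)
  case 0
  have "semistandard_tableaux 0 lam = {\<lambda>_. undefined}"
    by (auto simp: semistandard_tableaux_def diagram_def)
  then show ?case
    by (simp add: vandermonde_def schur_def diagram_def alternant_Leibniz)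
next
  case (Suc n)
  let ?l = "\<lambda>i. lam (Suc i) + (Suc n - Suc i)"
  let ?I = "\<Pi>\<^sub>E i\<in>{1..n}. {lam (Suc i)..lam i}"
  let ?J = "\<Pi>\<^sub>E i\<in>{..<n}. {?l (Suc i)..<?l i}"
  have dec: "?l (Suc i) < ?l i" if "i < n" for i
    using monotone_onD[OF Suc.prems, of "Suc i" "Suc (Suc i)"] that by auto
  have IH: "vandermonde n x * schur n nu x = alternant n (\<lambda>i. nu (Suc i) + (n - Suc i)) x"
    if "nu \<in> ?I" for nu
  proof (rule Suc.IH, rule monotone_onI)
    fix i j assume ij: "i \<in> {1..n}" "j \<in> {1..n}" "i \<le> j"
    \<comment> \<open>For \<open>i < j\<close>, interlacing gives
      \<open>nu j \<le> lam j \<le> lam (Suc i) \<le> nu i\<close>.\<close>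
    show "nu j \<le> nu i"
    proof (cases "i = j")
      case False
      then have "lam j \<le> lam (Suc i)"
        using ij by (intro monotone_onD[OF Suc.prems]) auto
      moreover have "nu j \<le> lam j" "lam (Suc i) \<le> nu i" using that ij by (auto simp: PiE_iff)
      ultimately show ?thesis by simp
    qed simp
  qed
  have "vandermonde (Suc n) x * schur (Suc n) lam x = (\<Prod>j<n. x j - x n) *
      (\<Sum>nu\<in>?I. x n ^ (lam (Suc n) + (\<Sum>i=1..n. lam i - nu i)) *
        (vandermonde n x * schur n nu x))"
    unfolding vandermonde_Suc schur_Suc[OF Suc.prems]
    by (simp add: sum_distrib_left mult_ac)
  also have "(\<Sum>nu\<in>?I. x n ^ (lam (Suc n) + (\<Sum>i=1..n. lam i - nu i)) *
        (vandermonde n x * schur n nu x)) =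
      (\<Sum>nu\<in>?I. x n ^ (lam (Suc n) + (\<Sum>i=1..n. lam i - nu i)) *
        alternant n (\<lambda>i. nu (Suc i) + (n - Suc i)) x)"
    using IH by simp
  also have "\<dots> = (\<Sum>f\<in>?J. x n ^ (?l n + (\<Sum>i<n. ?l i - 1 - f i)) * alternant n f x)"
  \<comment> \<open>Adding the staircase turns the closed interval for \<open>nu (Suc i)\<close>
    into the half-open interval from \<open>?l (Suc i)\<close> to \<open>?l i\<close>.\<close>
  proof (rule sum.reindex_bij_witness[of _ "\<lambda>f. \<lambda>i\<in>{1..n}. f (i - 1) - (n - i)"
        "\<lambda>nu. \<lambda>i\<in>{..<n}. nu (Suc i) + (n - Suc i)"], goal_cases)
    case (1 nu)
    then show ?case by (auto simp: fun_eq_iff PiE_iff extensional_def)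
  next
    case (2 nu)
    show ?case
    proof (rule PiE_I)
      fix i assume "i \<in> {..<n}"
      moreover from this have "nu (Suc i) \<in> {lam (Suc (Suc i))..lam (Suc i)}"
        using 2 by (intro PiE_mem[OF 2]) auto
      ultimately show "(\<lambda>i\<in>{..<n}. nu (Suc i) + (n - Suc i)) i \<in> {?l (Suc i)..<?l i}" by auto
    qed auto
  next
    case (3 f)
    show ?case
    proof
      fix i
      show "(\<lambda>i\<in>{..<n}. (\<lambda>i\<in>{1..n}. f (i - 1) - (n - i)) (Suc i) + (n - Suc i)) i = f i"
      proof (cases "i < n")
        case True
        then have "f i \<in> {?l (Suc i)..<?l i}" by (intro PiE_mem[OF 3]) auto
        then have "n - Suc i \<le> f i" by auto
        then show ?thesis using True by simp
      next
        case False
        then show ?thesis using PiE_arb[OF 3, of i] by simp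
      qed
    qed
  next
    case (4 f)
    have "lam (Suc i) \<le> f (i - 1) - (n - i) \<and> f (i - 1) - (n - i) \<le> lam i" if "i \<in> {1..n}" for i
    proof -
      have "f (i - 1) \<in> {?l (Suc (i - 1))..<?l (i - 1)}"
        using that by (intro PiE_mem[OF 4]) auto
      then show ?thesis using that by auto
    qed
    then show ?case by (auto simp: PiE_iff)
  next
    case (5 nu)
    \<comment> \<open>The \<open>- 1\<close> absorbs the difference between the staircases of
      lengths \<open>Suc n\<close> and \<open>n\<close>.\<close>
    have "(\<Sum>i<n. ?l i - 1 - (nu (Suc i) + (n - Suc i))) = (\<Sum>i=1..n. lam i - nu i)"
      by (rule sum.reindex_bij_witness[of _ "\<lambda>i. i - 1" Suc]) auto
    moreover have "alternant n (\<lambda>i\<in>{..<n}. nu (Suc i) + (n - Suc i)) x =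
        alternant n (\<lambda>i. nu (Suc i) + (n - Suc i)) x"
      by (rule alternant_cong) auto
    ultimately show ?case by simp
  qed
  also have "(\<Prod>j<n. x j - x n) * \<dots> = alternant (Suc n) ?l x"
    by (rule alternant_Suc[symmetric]) (rule dec)
  finally show ?case .
qed

text \<open>Reconciles polynomial variables numbered from 1 with determinant columns numbered from
  0.\<close>

abbreviation vars :: "nat \<Rightarrow> mpoly_int" where
  "vars \<equiv> \<lambda>i. var (Suc i)"

lemma single_eq_single_iff:
  "c \<noteq> 0 \<Longrightarrow> Poly_Mapping.single a c = Poly_Mapping.single b c \<longleftrightarrow> a = b"
  by (metis lookup_single_eq lookup_single_not_eq)

text \<open>In an integral domain it suffices that each factor is nonzero. This licenses every later
  cancellation of the Vandermonde product.\<close>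

lemma vandermonde_vars_nonzero: "vandermonde n vars \<noteq> 0"
proof -
  have fin: "finite {(i, j). i < j \<and> j < n}"
    by (rule finite_subset[of _ "{..<n} \<times> {..<n}"]) auto
  have "vars i - vars j \<noteq> 0" if "i < j" for i j
    using that by (simp add: var_def single_eq_single_iff)
  then show ?thesis
    unfolding vandermonde_def prod_zero_iff[OF fin] by auto
qed

lemma schur_poly_eq_schur: "schur_poly n lam = schur n lam vars"
  unfolding schur_poly_def schur_def
proof (intro sum.cong prod.cong refl)
  fix T b assume "T \<in> semistandard_tableaux n lam" "b \<in> diagram n lam"
  from semistandard_tableaux_range[OF this] show "var (T b) = vars (T b - 1)" by simp
qed

section \<open>Symmetry of Schur polynomials and their products with alternants\<close>

lemma schur_zero: "schur n (\<lambda>_. 0) x = 1"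
proof -
  have "semistandard_tableaux n (\<lambda>_. 0) = {\<lambda>_. undefined}"
    by (auto simp: semistandard_tableaux_def diagram_def)
  then show ?thesis by (simp add: schur_def diagram_def)
qed

text \<open>The bialternant formula for the empty partition.\<close>

lemma vandermonde_eq_alternant: "vandermonde n x = alternant n (\<lambda>i. n - Suc i) x"
  using bialternant_formula[of n "\<lambda>_. 0" x] by (simp add: schur_zero monotone_on_def)

text \<open>By the bialternant formula a Schur polynomial is a quotient of two alternants, and the
  sign of \<open>p\<close> cancels.\<close>

lemma schur_symmetric:
  fixes x :: "nat \<Rightarrow> 'a::idom"
  assumes nz: "vandermonde n x \<noteq> 0" and lam: "antimono_on {1..n} lam"
    and p: "p permutes {0..<n}"
  shows "schur n lam (x \<circ> p) = schur n lam x"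
proof -
  have s: "signof p \<noteq> (0::'a)" by (simp add: sign_def)
  have "signof p * (vandermonde n x * schur n lam (x \<circ> p)) =
      vandermonde n (x \<circ> p) * schur n lam (x \<circ> p)"
    by (simp add: vandermonde_eq_alternant alternant_permute_variables[OF p])
  also have "\<dots> = signof p * (vandermonde n x * schur n lam x)"
    by (simp add: bialternant_formula[OF lam] alternant_permute_variables[OF p])
  finally show ?thesis using nz s by simp
qed

text \<open>The exponent vector of the monomial of \<open>T\<close>, numbered from 0 like the
  variables of \<open>schur\<close>.\<close>

definition content :: "nat \<Rightarrow> (nat \<Rightarrow> nat) \<Rightarrow> (nat \<times> nat \<Rightarrow> nat) \<Rightarrow> nat \<Rightarrow> nat" where
  "content n lam T i = card {b \<in> diagram n lam. T b - 1 = i}"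

lemma schur_content:
  "schur n lam x = (\<Sum>T\<in>semistandard_tableaux n lam. \<Prod>i<n. x i ^ content n lam T i)"
  unfolding schur_def
proof (rule sum.cong[OF refl])
  fix T assume T: "T \<in> semistandard_tableaux n lam"
  have "(\<lambda>b. T b - 1) ` diagram n lam \<subseteq> {..<n}"
    using semistandard_tableaux_range[OF T] by fastforce
  then have "(\<Prod>b\<in>diagram n lam. x (T b - 1)) =
      (\<Prod>i<n. \<Prod>b\<in>{b \<in> diagram n lam. T b - 1 = i}. x (T b - 1))"
    by (intro prod.group[symmetric]) auto
  also have "\<dots> = (\<Prod>i<n. \<Prod>b\<in>{b \<in> diagram n lam. T b - 1 = i}. x i)"
    by (intro prod.cong) auto
  finally show "(\<Prod>b\<in>diagram n lam. x (T b - 1)) = (\<Prod>i<n. x i ^ content n lam T i)"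
    by (simp add: content_def)
qed

lemma sum_content:
  assumes T: "T \<in> semistandard_tableaux n lam"
  shows "(\<Sum>i<n. content n lam T i) = (\<Sum>i=1..n. lam i)"
proof -
  have "(\<lambda>b. T b - 1) ` diagram n lam \<subseteq> {..<n}"
    using semistandard_tableaux_range[OF T] by fastforce
  then have "(\<Sum>i<n. \<Sum>b\<in>{b \<in> diagram n lam. T b - 1 = i}. 1) = (\<Sum>b\<in>diagram n lam. 1::nat)"
    by (intro sum.group) auto
  then show ?thesis by (simp add: content_def card_diagram)
qed

text \<open>In each term of the Leibniz expansion of the alternant the symmetric factor is rewritten in
  the correspondingly permuted variables.\<close>

lemma alternant_mult_schur:
  fixes x :: "nat \<Rightarrow> 'a::idom"
  assumes nz: "vandermonde n x \<noteq> 0" and lam: "antimono_on {1..n} lam"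
  shows "alternant n l x * schur n lam x =
    (\<Sum>T\<in>semistandard_tableaux n lam. alternant n (\<lambda>i. l i + content n lam T i) x)"
proof -
  have "alternant n l x * schur n lam x =
      (\<Sum>p | p permutes {0..<n}. signof p * (\<Prod>i<n. x (p i) ^ l i) * schur n lam (x \<circ> p))"
    unfolding alternant_Leibniz sum_distrib_right
    by (intro sum.cong) (auto simp: schur_symmetric[OF nz lam])
  also have "\<dots> = (\<Sum>p | p permutes {0..<n}. \<Sum>T\<in>semistandard_tableaux n lam.
      signof p * (\<Prod>i<n. x (p i) ^ (l i + content n lam T i)))"
    by (simp add: schur_content sum_distrib_left power_add prod.distrib mult_ac)
  also have "\<dots> = (\<Sum>T\<in>semistandard_tableaux n lam. alternant n (\<lambda>i. l i + content n lam T i) x)"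
    unfolding alternant_Leibniz by (rule sum.swap)
  finally show ?thesis .
qed

subsection \<open>Powers as integral combinations of Schur polynomials\<close>

lemma finite_partitions [simp]: "finite (partitions n d)"
proof (rule finite_subset)
  show "partitions n d \<subseteq> {f. \<forall>i. (i \<in> {1..n} \<longrightarrow> f i \<in> {..d}) \<and> (i \<notin> {1..n} \<longrightarrow> f i = 0)}"
  proof
    fix f assume f: "f \<in> partitions n d"
    have "f i \<le> d" if "i \<in> {1..n}" for i
      using member_le_sum[OF that, of f] f by (auto simp: partitions_def)
    then show "f \<in> {f. \<forall>i. (i \<in> {1..n} \<longrightarrow> f i \<in> {..d}) \<and> (i \<notin> {1..n} \<longrightarrow> f i = 0)}"
      using f by (auto simp: partitions_def)
  qed
  show "finite {f. \<forall>i. (i \<in> {1..n} \<longrightarrow> f i \<in> {..d}) \<and> (i \<notin> {1..n} \<longrightarrow> f i = (0::nat))}"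
    by (rule finite_set_of_finite_funs) auto
qed

lemma partitions_antimono_on: "lam \<in> partitions n d \<Longrightarrow> antimono_on {1..n} lam"
  by (auto simp: partitions_def monotone_on_def)

text \<open>The lattice of integral combinations of the alternants with exponents \<open>nu\<close>
  plus staircase. Divided by the Vandermonde product, it consists of the integral combinations of
  Schur polynomials of degree \<open>d\<close>.\<close>

definition alternant_span :: "nat \<Rightarrow> nat \<Rightarrow> mpoly_int set" where
  "alternant_span n d = range (\<lambda>c. \<Sum>nu\<in>partitions n d.
     of_int (c nu) * alternant n (\<lambda>i. nu (Suc i) + (n - Suc i)) vars)"

lemma alternant_spanI:
  "F = (\<Sum>nu\<in>partitions n d. of_int (c nu) * alternant n (\<lambda>i. nu (Suc i) + (n - Suc i)) vars) \<Longrightarrow>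
    F \<in> alternant_span n d"
  unfolding alternant_span_def by blast

lemma alternant_span_of_int_mult:
  assumes "F \<in> alternant_span n d"
  shows "of_int z * F \<in> alternant_span n d"
proof -
  obtain c where "F = (\<Sum>nu\<in>partitions n d.
      of_int (c nu) * alternant n (\<lambda>i. nu (Suc i) + (n - Suc i)) vars)"
    using assms by (auto simp: alternant_span_def)
  then have "of_int z * F = (\<Sum>nu\<in>partitions n d.
      of_int (z * c nu) * alternant n (\<lambda>i. nu (Suc i) + (n - Suc i)) vars)"
    by (simp add: sum_distrib_left mult_ac)
  then show ?thesis by (rule alternant_spanI)
qed

lemma alternant_span_sum:
  assumes "\<And>t. t \<in> A \<Longrightarrow> F t \<in> alternant_span n d"
  shows "(\<Sum>t\<in>A. F t) \<in> alternant_span n d"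
proof -
  have "\<exists>c. \<forall>t\<in>A. F t = (\<Sum>nu\<in>partitions n d.
      of_int (c t nu) * alternant n (\<lambda>i. nu (Suc i) + (n - Suc i)) vars)"
    using assms unfolding alternant_span_def by (intro bchoice) blast
  then obtain c where "\<And>t. t \<in> A \<Longrightarrow> F t = (\<Sum>nu\<in>partitions n d.
      of_int (c t nu) * alternant n (\<lambda>i. nu (Suc i) + (n - Suc i)) vars)"
    by blast
  then have "(\<Sum>t\<in>A. F t) = (\<Sum>t\<in>A. \<Sum>nu\<in>partitions n d.
      of_int (c t nu) * alternant n (\<lambda>i. nu (Suc i) + (n - Suc i)) vars)"
    by simp
  also have "\<dots> = (\<Sum>nu\<in>partitions n d.
      of_int (\<Sum>t\<in>A. c t nu) * alternant n (\<lambda>i. nu (Suc i) + (n - Suc i)) vars)"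
    by (subst sum.swap) (simp add: sum_distrib_right)
  finally show ?thesis by (rule alternant_spanI)
qed

text \<open>The increasing enumeration \<open>h\<close> of the values of \<open>l\<close> is run
  backwards and pulled back along \<open>l\<close>.\<close>

lemma ex_permutation_strictly_decreasing:
  fixes l :: "nat \<Rightarrow> nat"
  assumes inj: "inj_on l {..<n}"
  shows "\<exists>p. p permutes {0..<n} \<and> (\<forall>i j. i < j \<longrightarrow> j < n \<longrightarrow> l (p j) < l (p i))"
proof -
  obtain h where h: "bij_betw h {..<n} (l ` {..<n})" "strict_mono_on {..<n} h"
    using ex_bij_betw_strict_mono_card[of "l ` {..<n}"] by (auto simp: card_image[OF inj])
  have rev: "bij_betw (\<lambda>i. n - Suc i) {..<n} {..<n}"
    by (rule bij_betw_byWitness[of _ "\<lambda>i. n - Suc i"]) auto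
  have l: "bij_betw (inv_into {..<n} l) (l ` {..<n}) {..<n}"
    using inj by (intro bij_betw_inv_into) (rule inj_on_imp_bij_betw)
  define q where "q = inv_into {..<n} l \<circ> h \<circ> (\<lambda>i. n - Suc i)"
  \<comment> \<open>\<open>permutes\<close> demands the identity outside the index range.\<close>
  define p where "p i = (if i < n then q i else i)" for i
  have q: "bij_betw q {..<n} {..<n}"
    unfolding q_def by (intro bij_betw_trans[OF rev] bij_betw_trans[OF h(1)] l)
  then have "bij_betw p {..<n} {..<n}"
    by (rule bij_betw_cong[THEN iffD1, rotated]) (simp add: p_def)
  then have "p permutes {..<n}"
    by (rule bij_imp_permutes) (simp add: p_def)
  moreover have "l (p i) = h (n - Suc i)" if "i < n" for i
  proof -
    have "h (n - Suc i) \<in> l ` {..<n}"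
      using bij_betwE[OF h(1)] that by auto
    then show ?thesis using that by (simp add: p_def q_def f_inv_into_f)
  qed
  then have "l (p j) < l (p i)" if "i < j" "j < n" for i j
    using that strict_mono_onD[OF h(2), of "n - Suc j" "n - Suc i"] by simp
  ultimately show ?thesis by (auto simp: atLeast0LessThan)
qed

text \<open>A repeated exponent gives 0. Otherwise sorting costs a sign, and subtracting the
  staircase from the sorted exponents leaves a partition whose size is fixed by
  \<open>sum\<close>.\<close>

lemma alternant_in_span:
  assumes sum: "(\<Sum>i<n. l i) = d + (\<Sum>i<n. n - Suc i)"
  shows "alternant n l vars \<in> alternant_span n d"
proof (cases "inj_on l {..<n}")
  case False
  then obtain i j where "i < n" "j < n" "i \<noteq> j" "l i = l j" by (auto simp: inj_on_def)
  then have "alternant n l vars = of_int 0"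
    by (simp add: alternant_repeated_exponent)
  also have "\<dots> = (\<Sum>nu\<in>partitions n d.
      of_int ((\<lambda>_. 0) nu) * alternant n (\<lambda>i. nu (Suc i) + (n - Suc i)) vars)" by simp
  finally show ?thesis by (rule alternant_spanI)
next
  case True
  then obtain p where p: "p permutes {0..<n}" and dec: "\<And>i j. i < j \<Longrightarrow> j < n \<Longrightarrow> l (p j) < l (p i)"
    using ex_permutation_strictly_decreasing[OF True] by blast
  define nu where "nu i = (if i \<in> {1..n} then l (p (i - 1)) - (n - i) else 0)" for i
  \<comment> \<open>A strictly decreasing sequence drops by at least 1 per step. Hence
    \<open>nu\<close> is weakly decreasing and, by \<open>ge\<close>, the subtraction defining
    \<open>nu\<close> is not truncated.\<close>
  have gap: "l (p j) + (j - i) \<le> l (p i)" if "i \<le> j" "j < n" for i j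
    using that
  proof (induction j rule: dec_induct)
    case (step j)
    then show ?case using dec[of j "Suc j"] by simp
  qed simp
  have ge: "n - Suc i \<le> l (p i)" if "i < n" for i
  proof -
    have "l (p (n - 1)) + (n - 1 - i) \<le> l (p i)" using that by (intro gap) auto
    then show ?thesis by linarith
  qed
  have nu: "nu (Suc i) + (n - Suc i) = l (p i)" if "i < n" for i
    using that ge[OF that] by (simp add: nu_def)
  have "(\<Sum>i<n. nu (Suc i)) + (\<Sum>i<n. n - Suc i) = (\<Sum>i<n. l (p i))"
    using nu by (simp flip: sum.distrib)
  also have "\<dots> = (\<Sum>i<n. l i)"
    using sum.permute[of p "{..<n}" l] p by (simp add: o_def atLeast0LessThan)
  finally have "(\<Sum>i<n. nu (Suc i)) = d" using sum by simp
  moreover have "(\<Sum>i<n. nu (Suc i)) = (\<Sum>i=1..n. nu i)"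
    by (rule sum.reindex_bij_witness[of _ "\<lambda>i. i - 1" Suc]) auto
  moreover have "nu j \<le> nu i" if "i \<in> {1..n}" "j \<in> {1..n}" "i \<le> j" for i j
  proof -
    have "l (p (j - 1)) + (j - 1 - (i - 1)) \<le> l (p (i - 1))" using that by (intro gap) auto
    then show ?thesis using that by (simp add: nu_def)
  qed
  ultimately have part: "nu \<in> partitions n d" by (auto simp: partitions_def nu_def)
  have ss: "signof p * signof p = (1 :: mpoly_int)" by (simp add: sign_def)
  have "alternant n l vars = signof p * alternant n (l \<circ> p) vars"
    using ss by (simp add: alternant_permute_exponents[OF p] flip: mult.assoc)
  also have "alternant n (l \<circ> p) vars = alternant n (\<lambda>i. nu (Suc i) + (n - Suc i)) vars"
    by (rule alternant_cong) (simp only: nu o_apply)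
  \<comment> \<open>The coefficient function is supported at \<open>nu\<close> alone, with value
    \<open>sign p\<close>.\<close>
  also have "signof p * \<dots> = (\<Sum>mu\<in>{nu}. of_int (if mu = nu then sign p else 0) *
      alternant n (\<lambda>i. mu (Suc i) + (n - Suc i)) vars)"
    by simp
  also have "\<dots> = (\<Sum>mu\<in>partitions n d. of_int (if mu = nu then sign p else 0) *
      alternant n (\<lambda>i. mu (Suc i) + (n - Suc i)) vars)"
    using part by (intro sum.mono_neutral_left) auto
  finally show ?thesis by (rule alternant_spanI)
qed

text \<open>The product is again a sum of alternants, and the content of each tableau raises the
  total exponent by exactly \<open>k\<close>.\<close>

lemma alternant_span_mult_schur:
  assumes F: "F \<in> alternant_span n d" and lam: "lam \<in> partitions n k"
  shows "F * schur n lam vars \<in> alternant_span n (d + k)"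
proof -
  obtain c where F: "F = (\<Sum>nu\<in>partitions n d.
      of_int (c nu) * alternant n (\<lambda>i. nu (Suc i) + (n - Suc i)) vars)"
    using F by (auto simp: alternant_span_def)
  have "F * schur n lam vars = (\<Sum>nu\<in>partitions n d. of_int (c nu) *
      (\<Sum>T\<in>semistandard_tableaux n lam.
        alternant n (\<lambda>i. nu (Suc i) + (n - Suc i) + content n lam T i) vars))"
    unfolding F sum_distrib_right mult.assoc
    by (simp only: alternant_mult_schur[OF vandermonde_vars_nonzero partitions_antimono_on[OF lam]])
  also have "\<dots> \<in> alternant_span n (d + k)"
  proof (intro alternant_span_sum alternant_span_of_int_mult alternant_in_span)
    fix nu T assume nu: "nu \<in> partitions n d" and T: "T \<in> semistandard_tableaux n lam"
    have "(\<Sum>i<n. nu (Suc i)) = (\<Sum>i=1..n. nu i)"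
      by (rule sum.reindex_bij_witness[of _ "\<lambda>i. i - 1" Suc]) auto
    then show "(\<Sum>i<n. nu (Suc i) + (n - Suc i) + content n lam T i) = d + k + (\<Sum>i<n. n - Suc i)"
      using nu lam sum_content[OF T] unfolding sum.distrib by (simp add: partitions_def)
  qed
  finally show ?thesis .
qed

lemma one_row_in_partitions: "1 \<le> n \<Longrightarrow> one_row k \<in> partitions n k"
  by (auto simp: partitions_def one_row_def)

text \<open>The induction starts at the Vandermonde product, the alternant whose exponents are the
  bare staircase.\<close>

lemma vandermonde_mult_schur_power_in_span:
  assumes "lam \<in> partitions n k"
  shows "vandermonde n vars * schur n lam vars ^ L \<in> alternant_span n (k * L)"
proof (induction L)
  case 0
  show ?case by (simp add: vandermonde_eq_alternant alternant_in_span)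
next
  case (Suc L)
  show ?case using alternant_span_mult_schur[OF Suc.IH assms] by (simp add: mult_ac add.commute)
qed

text \<open>Each spanning alternant is the Vandermonde product times a Schur polynomial, and that
  common factor cancels.\<close>

theorem schur_power_expansion:
  assumes "lam \<in> partitions n k"
  obtains c where
    "schur n lam vars ^ L = (\<Sum>nu\<in>partitions n (k * L). of_int (c nu) * schur n nu vars)"
proof -
  obtain c where "vandermonde n vars * schur n lam vars ^ L = (\<Sum>nu\<in>partitions n (k * L).
      of_int (c nu) * alternant n (\<lambda>i. nu (Suc i) + (n - Suc i)) vars)"
    using vandermonde_mult_schur_power_in_span[OF assms, of L] by (auto simp: alternant_span_def)
  also have "\<dots> = (\<Sum>nu\<in>partitions n (k * L).
      of_int (c nu) * (vandermonde n vars * schur n nu vars))"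
    by (intro sum.cong refl) (simp only: bialternant_formula[OF partitions_antimono_on])
  also have "\<dots> = vandermonde n vars * (\<Sum>nu\<in>partitions n (k * L). of_int (c nu) * schur n nu vars)"
    by (simp add: sum_distrib_left mult_ac)
  finally show ?thesis using that vandermonde_vars_nonzero[of n] by simp
qed

subsection \<open>Coefficients and multiplicities\<close>

lemma lookup_single_mult_add:
  fixes F :: mpoly_int
  shows "Poly_Mapping.lookup (Poly_Mapping.single m c * F) (m + e) = c * Poly_Mapping.lookup F e"
proof -
  have "Poly_Mapping.lookup (Poly_Mapping.single m c * F) (m + e) =
      (\<Sum>l. (c when m = l) * (\<Sum>q. Poly_Mapping.lookup F q when m + e = l + q))"
    by (simp add: lookup_mult lookup_single)
  also have "\<dots> = (\<Sum>l. (c * (\<Sum>q. Poly_Mapping.lookup F q when m + e = l + q)) when m = l)"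
    by (simp add: when_mult)
  also have "\<dots> = c * (\<Sum>q. Poly_Mapping.lookup F q when e = q)"
    by simp
  finally show ?thesis by simp
qed

lemma lookup_single_mult_zero:
  fixes F :: mpoly_int
  assumes "Poly_Mapping.lookup e i < Poly_Mapping.lookup m i"
  shows "Poly_Mapping.lookup (Poly_Mapping.single m c * F) e = 0"
proof (rule ccontr)
  assume "Poly_Mapping.lookup (Poly_Mapping.single m c * F) e \<noteq> 0"
  then have "e \<in> Poly_Mapping.keys (Poly_Mapping.single m c * F)" by (simp add: in_keys_iff)
  then obtain q where "e = m + q"
    using keys_mult[of "Poly_Mapping.single m c" F] by (auto split: if_splits)
  then show False using assms by (simp add: lookup_add)
qed

lemma lookup_of_int_mult:
  fixes F :: mpoly_int
  shows "Poly_Mapping.lookup (of_int c * F) e = c * Poly_Mapping.lookup F e"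
proof -
  have "(of_int c :: mpoly_int) = Poly_Mapping.single 0 c" by (simp flip: single_of_int)
  then show ?thesis using lookup_single_mult_add[of 0 c F e] by simp
qed

section \<open>Monomials and coefficients of alternants\<close>

lemma var_power: "var i ^ m = Poly_Mapping.single (Poly_Mapping.single i m) 1"
  by (induction m) (simp_all add: var_def mult_single flip: single_add)

lemma prod_single: "(\<Prod>i\<in>A. Poly_Mapping.single (e i) 1) = (Poly_Mapping.single (\<Sum>i\<in>A. e i) 1 :: mpoly_int)"
  by (induction A rule: infinite_finite_induct) (simp_all add: mult_single)

definition exponent :: "nat \<Rightarrow> (nat \<Rightarrow> nat) \<Rightarrow> nat \<Rightarrow>\<^sub>0 nat" where
  "exponent n m = (\<Sum>i<n. Poly_Mapping.single (Suc i) (m i))"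

lemma lookup_exponent: "i < n \<Longrightarrow> Poly_Mapping.lookup (exponent n m) (Suc i) = m i"
  by (simp add: exponent_def lookup_sum lookup_single when_def)

lemma permutes_strict_mono_id:
  fixes p :: "nat \<Rightarrow> nat"
  assumes p: "p permutes {0..<n}" and mono: "\<And>i j. i < j \<Longrightarrow> j < n \<Longrightarrow> p i < p j"
  shows "p = id"
proof (rule permutes_natset_ge[OF p], rule ballI)
  fix i assume "i \<in> {0..<n}"
  then show "i \<le> p i"
  proof (induction i)
    case (Suc i)
    then show ?case using mono[of i "Suc i"] by auto
  qed simp
qed

text \<open>The Leibniz term of \<open>p\<close> hits the monomial only if
  \<open>l i = m (p i)\<close> for all \<open>i < n\<close>. Both sequences strictly decrease, so
  \<open>p\<close> increases and is the identity, with sign 1.\<close>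

lemma lookup_alternant:
  assumes l: "\<And>i j. i < j \<Longrightarrow> j < n \<Longrightarrow> l j < l i" and m: "\<And>i j. i < j \<Longrightarrow> j < n \<Longrightarrow> m j < m i"
  shows "Poly_Mapping.lookup (alternant n l vars) (exponent n m) = (if \<forall>i<n. l i = m i then 1 else 0)"
proof -
  have monom: "(\<Prod>i<n. vars (p i) ^ l i) = Poly_Mapping.single (\<Sum>i<n. Poly_Mapping.single (Suc (p i)) (l i)) 1"
    for p by (simp add: var_power prod_single)
  have eq: "(\<Sum>i<n. Poly_Mapping.single (Suc (p i)) (l i)) = exponent n m \<longleftrightarrow>
      p = id \<and> (\<forall>i<n. l i = m i)" if p: "p permutes {0..<n}" for p
  proof
    assume e: "(\<Sum>i<n. Poly_Mapping.single (Suc (p i)) (l i)) = exponent n m"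
    have pi: "p i < n" if "i < n" for i using permutes_in_image[OF p, of i] that by simp
    have lm: "l i = m (p i)" if "i < n" for i
    proof -
      have "Poly_Mapping.lookup (\<Sum>i<n. Poly_Mapping.single (Suc (p i)) (l i)) (Suc (p i)) =
          (\<Sum>j<n. l j when p j = p i)"
        by (simp add: lookup_sum lookup_single)
      also have "\<dots> = (\<Sum>j<n. l j when j = i)"
        by (simp add: inj_eq[OF permutes_inj[OF p]])
      also have "\<dots> = l i" using that by (simp add: when_def)
      finally show ?thesis using lookup_exponent[OF pi[OF that], of m] by (simp add: e)
    qed
    have "p i < p j" if "i < j" "j < n" for i j
    proof (rule ccontr)
      assume "\<not> p i < p j"
      moreover have "p i \<noteq> p j" using that inj_eq[OF permutes_inj[OF p]] by auto
      ultimately have "m (p i) < m (p j)" using that pi[of i] by (intro m) auto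
      then show False using l[OF that] that by (simp add: lm)
    qed
    then have "p = id" by (rule permutes_strict_mono_id[OF p])
    then show "p = id \<and> (\<forall>i<n. l i = m i)" using lm by simp
  qed (simp add: exponent_def)
  have "Poly_Mapping.lookup (alternant n l vars) (exponent n m) =
      (\<Sum>p | p permutes {0..<n}. sign p *
        (1 when (\<Sum>i<n. Poly_Mapping.single (Suc (p i)) (l i)) = exponent n m))"
    unfolding alternant_Leibniz monom lookup_sum lookup_of_int_mult lookup_single ..
  also have "\<dots> = (\<Sum>p | p permutes {0..<n}. if p = id then (if \<forall>i<n. l i = m i then 1 else 0) else 0)"
    by (intro sum.cong) (auto simp: eq when_def)
  also have "\<dots> = (if \<forall>i<n. l i = m i then 1 else 0)"
    by (subst sum.delta) (auto simp: finite_permutations permutes_id)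
  finally show ?thesis .
qed

text \<open>Adding the staircase makes exponents strictly decreasing, so
  \<open>lookup_alternant\<close> applies. The resulting functionals are dual to the Schur
  polynomials.\<close>

lemma lookup_vandermonde_mult_schur:
  assumes lam: "lam \<in> partitions n d" and nu: "nu \<in> partitions n d"
  shows "Poly_Mapping.lookup (vandermonde n vars * schur n nu vars)
    (exponent n (\<lambda>i. lam (Suc i) + (n - Suc i))) = (if nu = lam then 1 else 0)"
proof -
  have dec: "mu (Suc j) + (n - Suc j) < mu (Suc i) + (n - Suc i)"
    if "mu \<in> partitions n d" "i < j" "j < n" for mu i j
    using monotone_onD[OF partitions_antimono_on[OF that(1)], of "Suc i" "Suc j"] that(2,3) by simp
  have "(\<forall>i<n. nu (Suc i) + (n - Suc i) = lam (Suc i) + (n - Suc i)) \<longleftrightarrow> nu = lam"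
  proof
    assume eq: "\<forall>i<n. nu (Suc i) + (n - Suc i) = lam (Suc i) + (n - Suc i)"
    show "nu = lam"
    proof
      fix i
      show "nu i = lam i"
      proof (cases "i \<in> {1..n}")
        case True
        then have "i - 1 < n" "Suc (i - 1) = i" by auto
        then have "nu i + (n - i) = lam i + (n - i)" using eq by metis
        then show ?thesis by simp
      next
        case False
        then show ?thesis using lam nu by (simp add: partitions_def)
      qed
    qed
  qed simp
  then show ?thesis
    using lookup_alternant[OF dec[OF nu] dec[OF lam]]
    by (simp add: bialternant_formula[OF partitions_antimono_on[OF nu]])
qed

lemma lookup_vandermonde_mult_expansion:
  assumes lam: "lam \<in> partitions n d"
    and F: "F = (\<Sum>nu\<in>partitions n d. of_int (c nu) * schur n nu vars)"
  shows "Poly_Mapping.lookup (vandermonde n vars * F) (exponent n (\<lambda>i. lam (Suc i) + (n - Suc i))) = c lam"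
proof -
  have "vandermonde n vars * F =
      (\<Sum>nu\<in>partitions n d. of_int (c nu) * (vandermonde n vars * schur n nu vars))"
    by (simp add: F sum_distrib_left mult_ac)
  then have "Poly_Mapping.lookup (vandermonde n vars * F) (exponent n (\<lambda>i. lam (Suc i) + (n - Suc i))) =
      (\<Sum>nu\<in>partitions n d. c nu * (if nu = lam then 1 else 0))"
    by (simp only: lookup_sum lookup_of_int_mult lookup_vandermonde_mult_schur[OF lam] cong: sum.cong)
  also have "\<dots> = c lam" using lam by (simp add: if_distrib cong: if_cong)
  finally show ?thesis .
qed

text \<open>The definite description needs existence, from \<open>schur_power_expansion\<close>, and
  uniqueness, from reading coefficients off an arbitrary expansion.\<close>

lemma multiplicity_eq_lookup:
  assumes lam: "lam \<in> partitions (r + 1) (k * L)"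
  shows "multiplicity_in_tensor_power r k L lam =
    Poly_Mapping.lookup (vandermonde (r + 1) vars * tensor_power_char r k L)
      (exponent (r + 1) (\<lambda>i. lam (Suc i) + (r + 1 - Suc i)))"
proof -
  let ?P = "partitions (r + 1) (k * L)"
  \<comment> \<open>The explicit candidate; the value 0 off \<open>?P\<close> meets the normalizing
    clause.\<close>
  define mu where "mu nu = (if nu \<in> ?P then
    Poly_Mapping.lookup (vandermonde (r + 1) vars * tensor_power_char r k L)
      (exponent (r + 1) (\<lambda>i. nu (Suc i) + (r + 1 - Suc i))) else 0)" for nu
  have tpc: "tensor_power_char r k L = schur (r + 1) (one_row k) vars ^ L"
    by (simp add: tensor_power_char_def schur_poly_eq_schur)
  have uniq: "c nu = mu nu" if "nu \<in> ?P"
    "tensor_power_char r k L = (\<Sum>nu\<in>?P. of_int (c nu) * schur (r + 1) nu vars)" for c nu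
    using lookup_vandermonde_mult_expansion[OF that] that(1) by (simp add: mu_def)
  have "one_row k \<in> partitions (r + 1) k" by (rule one_row_in_partitions) simp
  then obtain c where c: "tensor_power_char r k L = (\<Sum>nu\<in>?P. of_int (c nu) * schur (r + 1) nu vars)"
    unfolding tpc by (rule schur_power_expansion)
  note c
  also have "(\<Sum>nu\<in>?P. of_int (c nu) * schur (r + 1) nu vars) = (\<Sum>nu\<in>?P. of_int (mu nu) * schur (r + 1) nu vars)"
    using uniq[OF _ c] by (intro sum.cong) auto
  finally have "multiplicity_in_tensor_power r k L = mu"
    unfolding multiplicity_in_tensor_power_def schur_poly_eq_schur
  proof (intro the_equality conjI allI impI)
    fix mu' assume mu': "(\<forall>nu. nu \<notin> ?P \<longrightarrow> mu' nu = 0) \<and>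
      tensor_power_char r k L = (\<Sum>nu\<in>?P. of_int (mu' nu) * schur (r + 1) nu vars)"
    show "mu' = mu"
    proof
      fix nu show "mu' nu = mu nu"
        using mu' uniq[of nu mu'] by (cases "nu \<in> ?P") (auto simp: mu_def)
    qed
  qed (auto simp: mu_def)
  then show ?thesis using lam by (simp add: mu_def)
qed

subsection \<open>The shift operator\<close>

text \<open>Extension by zero to integer exponents makes multiplication by a variable a plain
  shift.\<close>

definition int_coeff :: "nat \<Rightarrow> mpoly_int \<Rightarrow> (nat \<Rightarrow> int) \<Rightarrow> int" where
  "int_coeff n F e = (if \<forall>i\<in>{1..n}. 0 \<le> e i
     then Poly_Mapping.lookup F (\<Sum>i=1..n. Poly_Mapping.single i (nat (e i))) else 0)"

lemma int_coeff_cong: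
  assumes "\<And>i. i \<in> {1..n} \<Longrightarrow> e i = e' i"
  shows "int_coeff n F e = int_coeff n F e'"
proof -
  have "(\<forall>i\<in>{1..n}. 0 \<le> e i) \<longleftrightarrow> (\<forall>i\<in>{1..n}. 0 \<le> e' i)" using assms by auto
  moreover have "(\<Sum>i=1..n. Poly_Mapping.single i (nat (e i))) =
      (\<Sum>i=1..n. Poly_Mapping.single i (nat (e' i)))"
    using assms by (intro sum.cong) auto
  ultimately show ?thesis by (simp only: int_coeff_def)
qed

lemma int_coeff_diff: "int_coeff n (F - G) e = int_coeff n F e - int_coeff n G e"
  by (simp add: int_coeff_def lookup_minus)

text \<open>If some exponent is negative, both sides are 0. If \<open>e a = 0\<close>, the right
  side is 0 by convention and the left because \<open>var a\<close> divides the product.\<close>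

lemma int_coeff_var_mult:
  assumes a: "a \<in> {1..n}"
  shows "int_coeff n (var a * F) e = int_coeff n F (e(a := e a - 1))"
proof (cases "\<forall>i\<in>{1..n}. 0 \<le> e i")
  case False
  then obtain i where "i \<in> {1..n}" "e i < 0" by force
  then have "\<not> 0 \<le> (e(a := e a - 1)) i" by auto
  then have "\<not> (\<forall>i\<in>{1..n}. 0 \<le> (e(a := e a - 1)) i)" using \<open>i \<in> {1..n}\<close> by blast
  then show ?thesis using False by (simp only: int_coeff_def if_False)
next
  case True
  let ?E = "\<lambda>e. \<Sum>i=1..n. Poly_Mapping.single i (nat (e i))"
  have split: "?E e = Poly_Mapping.single a (nat (e a)) + (\<Sum>i\<in>{1..n} - {a}. Poly_Mapping.single i (nat (e i)))"
    for e :: "nat \<Rightarrow> int" using a by (intro sum.remove) auto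
  show ?thesis
  proof (cases "e a = 0")
    case True
    then have "\<not> 0 \<le> (e(a := e a - 1)) a" by simp
    then have "\<not> (\<forall>i\<in>{1..n}. 0 \<le> (e(a := e a - 1)) i)" using a by blast
    moreover have "Poly_Mapping.lookup (?E e) a = 0"
      using True by (simp add: lookup_sum lookup_single when_def)
    then have "Poly_Mapping.lookup (var a * F) (?E e) = 0"
      unfolding var_def by (intro lookup_single_mult_zero[of _ a]) simp
    ultimately show ?thesis by (simp only: int_coeff_def if_False if_cancel)
  next
    case False
    then have pos: "1 \<le> e a" using True a by force
    then have "Poly_Mapping.single a (nat (e a)) =
        Poly_Mapping.single a 1 + Poly_Mapping.single a (nat (e a - 1))"
      by (simp flip: single_add add: nat_diff_distrib)
    then have "?E e = Poly_Mapping.single a 1 + ?E (e(a := e a - 1))"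
      unfolding split by (simp add: add.assoc)
    moreover have nonneg: "\<forall>i\<in>{1..n}. 0 \<le> (e(a := e a - 1)) i" using True pos by auto
    ultimately show ?thesis
      unfolding int_coeff_def if_P[OF True] if_P[OF nonneg]
      by (simp only: var_def lookup_single_mult_add mult_1)
  qed
qed

text \<open>Supports of differences and products are controlled only up to inclusion; summing over a
  larger set adds zero terms.\<close>

lemma shift_op_superset:
  assumes "finite K" "Poly_Mapping.keys P \<subseteq> K"
  shows "shift_op P f M = (\<Sum>\<beta>\<in>K. Poly_Mapping.lookup P \<beta> * f (\<lambda>i. M i - int (Poly_Mapping.lookup \<beta> i)))"
  unfolding shift_op_def using assms
  by (intro sum.mono_neutral_left) (auto simp: in_keys_iff)

lemma shift_op_one: "shift_op 1 f M = f M"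
  by (simp add: shift_op_def)

lemma shift_op_diff: "shift_op (P - Q) f M = shift_op P f M - shift_op Q f M"
proof -
  let ?K = "Poly_Mapping.keys P \<union> Poly_Mapping.keys Q"
  have "Poly_Mapping.keys (P - Q) \<subseteq> ?K" by (rule keys_diff)
  then show ?thesis
    by (simp add: shift_op_superset[of ?K] lookup_minus left_diff_distrib sum_subtractf)
qed

lemma shift_op_single_mult:
  "shift_op (Poly_Mapping.single m 1 * P) f M = shift_op P f (\<lambda>i. M i - int (Poly_Mapping.lookup m i))"
proof -
  let ?K = "(+) m ` Poly_Mapping.keys P"
  have "Poly_Mapping.keys (Poly_Mapping.single m 1 * P) \<subseteq> ?K"
    using keys_mult[of "Poly_Mapping.single m 1" P] by auto
  then have "shift_op (Poly_Mapping.single m 1 * P) f M = (\<Sum>\<beta>\<in>?K.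
      Poly_Mapping.lookup (Poly_Mapping.single m 1 * P) \<beta> * f (\<lambda>i. M i - int (Poly_Mapping.lookup \<beta> i)))"
    by (intro shift_op_superset) auto
  also have "\<dots> = shift_op P f (\<lambda>i. M i - int (Poly_Mapping.lookup m i))"
    unfolding shift_op_def
    by (subst sum.reindex) (auto simp: inj_on_def lookup_single_mult_add lookup_add diff_diff_eq)
  finally show ?thesis .
qed

lemma prod_var_interval: "(\<Prod>i\<in>{a..<b}. var i) =
    Poly_Mapping.single (\<Sum>i\<in>{a..<b}. Poly_Mapping.single i 1) 1"
  unfolding var_def by (rule prod_single)

text \<open>The exponent of the variable \<open>var i\<close> attached to \<open>M\<close>. Boundary
  values are imposed anew, so shifting \<open>M\<close> at 0 or \<open>r + 1\<close> has no
  effect.\<close>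

definition weight :: "nat \<Rightarrow> int \<Rightarrow> (nat \<Rightarrow> int) \<Rightarrow> nat \<Rightarrow> int" where
  "weight r N M i = with_boundary r N M (i - 1) - with_boundary r N M i"

text \<open>Lowering all of \<open>M a\<close>, ..., \<open>M (b - 1)\<close> by 1 changes
  consecutive differences only at the two ends of the interval.\<close>

lemma weight_shift:
  assumes "1 \<le> a" "a < b" "b \<le> r + 1" "i \<in> {1..r + 1}"
  shows "weight r N (\<lambda>j. M j - int (Poly_Mapping.lookup (\<Sum>i\<in>{a..<b}. Poly_Mapping.single i 1) j)) i =
    weight r N M i + of_bool (i = a) - of_bool (i = b)"
proof -
  have "Poly_Mapping.lookup (\<Sum>i\<in>{a..<b}. Poly_Mapping.single i 1) j = (of_bool (a \<le> j \<and> j < b) :: nat)" for j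
    by (simp add: lookup_sum lookup_single when_def)
  then show ?thesis
    using assms by (auto simp: weight_def with_boundary_def of_bool_def)
qed

text \<open>The chain of inequalities on \<open>M\<close> says exactly that all weights are
  nonnegative.\<close>

lemma weight_coeff_eq_int_coeff:
  "weight_coeff r k L M = int_coeff (r + 1) (tensor_power_char r k L) (weight r (int (k * L)) M)"
  by (simp add: weight_coeff_def int_coeff_def weight_def Let_def)

text \<open>The factor \<open>1 - t\<^sub>a \<cdots> t\<^sub>b\<^sub>-\<^sub>1\<close> acts on coefficients as \<open>1 - x\<^sub>b / x\<^sub>a\<close>, which becomes \<open>x\<^sub>a - x\<^sub>b\<close> after
  a shift of the exponent of \<open>x\<^sub>a\<close> by one.\<close>

lemma shift_op_prod_int_coeff:
  assumes "finite A" "A \<subseteq> {(a, b). 1 \<le> a \<and> a < b \<and> b \<le> r + 1}"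
  shows "shift_op (\<Prod>(a, b)\<in>A. 1 - (\<Prod>i\<in>{a..<b}. var i)) (\<lambda>M. int_coeff (r + 1) F (weight r N M)) M =
    int_coeff (r + 1) ((\<Prod>(a, b)\<in>A. var a - var b) * F)
      (\<lambda>i. weight r N M i + (\<Sum>(a, b)\<in>A. of_bool (i = a)))"
  using assms
proof (induction A arbitrary: M rule: finite_induct)
  case empty
  then show ?case by (simp add: shift_op_one)
next
  case (insert ab A)
  obtain a b where ab: "ab = (a, b)" by (cases ab)
  have bounds: "1 \<le> a" "a < b" "b \<le> r + 1" using insert.prems by (auto simp: ab)
  let ?R = "\<Prod>(a, b)\<in>A. 1 - (\<Prod>i\<in>{a..<b}. var i)"
  let ?G = "(\<Prod>(a, b)\<in>A. var a - var b) * F"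
  let ?f = "\<lambda>M. int_coeff (r + 1) F (weight r N M)"
  let ?m = "\<Sum>i\<in>{a..<b}. Poly_Mapping.single i 1"
  let ?e = "\<lambda>i. weight r N M i + (\<Sum>(a, b)\<in>A. of_bool (i = a))"
  have "shift_op (\<Prod>(a, b)\<in>insert ab A. 1 - (\<Prod>i\<in>{a..<b}. var i)) ?f M =
      shift_op (?R - Poly_Mapping.single ?m 1 * ?R) ?f M"
    using insert.hyps by (simp add: ab prod_var_interval left_diff_distrib)
  also have "\<dots> = shift_op ?R ?f M - shift_op ?R ?f (\<lambda>i. M i - int (Poly_Mapping.lookup ?m i))"
    by (simp add: shift_op_diff shift_op_single_mult)
  \<comment> \<open>The induction hypothesis is used at \<open>M\<close> and at its shift, which is
    why \<open>M\<close> is arbitrary.\<close>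
  also have "\<dots> = int_coeff (r + 1) ?G ?e - int_coeff (r + 1) ?G
      (\<lambda>i. weight r N (\<lambda>i. M i - int (Poly_Mapping.lookup ?m i)) i + (\<Sum>(a, b)\<in>A. of_bool (i = a)))"
    using insert.prems by (subst (1 2) insert.IH) auto
  also have "int_coeff (r + 1) ?G
      (\<lambda>i. weight r N (\<lambda>i. M i - int (Poly_Mapping.lookup ?m i)) i + (\<Sum>(a, b)\<in>A. of_bool (i = a))) =
      int_coeff (r + 1) ?G (\<lambda>i. ?e i + of_bool (i = a) - of_bool (i = b))"
  proof (rule int_coeff_cong)
    fix i assume "i \<in> {1..r + 1}"
    from weight_shift[OF bounds this, of N M]
    show "weight r N (\<lambda>i. M i - int (Poly_Mapping.lookup ?m i)) i + (\<Sum>(a, b)\<in>A. of_bool (i = a)) =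
        ?e i + of_bool (i = a) - of_bool (i = b)" by linarith
  qed
  \<comment> \<open>Relative to the exponent \<open>?e\<close> raised by 1 at \<open>a\<close>, the
    shifted term is lowered at \<open>b\<close> and the unshifted one at \<open>a\<close>; these are
    multiplications by \<open>var b\<close> and \<open>var a\<close>.\<close>
  also have "\<dots> = int_coeff (r + 1) (var b * ?G) (\<lambda>i. ?e i + of_bool (i = a))"
    using bounds by (subst int_coeff_var_mult) (auto intro!: int_coeff_cong)
  also have "int_coeff (r + 1) ?G ?e = int_coeff (r + 1) (var a * ?G) (\<lambda>i. ?e i + of_bool (i = a))"
    using bounds by (subst int_coeff_var_mult) (auto intro!: int_coeff_cong)
  also have "\<dots> - int_coeff (r + 1) (var b * ?G) (\<lambda>i. ?e i + of_bool (i = a)) =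
      int_coeff (r + 1) ((\<Prod>(a, b)\<in>insert ab A. var a - var b) * F)
        (\<lambda>i. weight r N M i + (\<Sum>(a, b)\<in>insert ab A. of_bool (i = a)))"
    using insert.hyps by (simp add: ab left_diff_distrib mult.assoc add_ac flip: int_coeff_diff)
  finally show ?case .
qed

text \<open>All positive roots at once: the factors form the Vandermonde product, and the
  accumulated shifts form the staircase.\<close>

lemma shift_op_weyl_denominator_weight_coeff:
  "shift_op (weyl_denominator r) (weight_coeff r k L) M =
    int_coeff (r + 1) (vandermonde (r + 1) vars * tensor_power_char r k L)
      (\<lambda>i. weight r (int (k * L)) M i + int (r + 1 - i))"
proof -
  let ?A = "{(a, b). 1 \<le> a \<and> a < b \<and> b \<le> r + 1}"
  have fin: "finite ?A"
    by (rule finite_subset[of _ "{..r + 1} \<times> {..r + 1}"]) auto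
  have van: "(\<Prod>(a, b)\<in>?A. var a - var b) = vandermonde (r + 1) vars"
    unfolding vandermonde_def
    by (rule prod.reindex_bij_witness[of _ "\<lambda>(i, j). (Suc i, Suc j)" "\<lambda>(a, b). (a - 1, b - 1)"]) auto
  \<comment> \<open>The pairs with first entry \<open>i\<close> have second entry among
    \<open>i + 1\<close>, ..., \<open>r + 1\<close>.\<close>
  have count: "(\<Sum>(a, b)\<in>?A. of_bool (i = a)) = int (r + 1 - i)" if "i \<in> {1..r + 1}" for i
  proof -
    have "(\<Sum>(a, b)\<in>?A. of_bool (i = a)) = (\<Sum>c\<in>?A. of_bool (c \<in> Pair i ` {i<..r + 1}) :: int)"
      by (intro sum.cong) auto
    also have "\<dots> = (\<Sum>c\<in>Pair i ` {i<..r + 1}. 1)"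
      using fin that by (intro sum.mono_neutral_cong_right) auto
    also have "\<dots> = int (r + 1 - i)" by (simp add: card_image inj_on_def)
    finally show ?thesis .
  qed
  have "shift_op (weyl_denominator r) (weight_coeff r k L) M =
      int_coeff (r + 1) (vandermonde (r + 1) vars * tensor_power_char r k L)
        (\<lambda>i. weight r (int (k * L)) M i + (\<Sum>(a, b)\<in>?A. of_bool (i = a)))"
    unfolding weyl_denominator_def weight_coeff_eq_int_coeff van[symmetric]
    by (rule shift_op_prod_int_coeff[OF fin]) simp
  also have "\<dots> = int_coeff (r + 1) (vandermonde (r + 1) vars * tensor_power_char r k L)
      (\<lambda>i. weight r (int (k * L)) M i + int (r + 1 - i))"
    by (rule int_coeff_cong) (simp only: count)
  finally show ?thesis .
qed

theorem theorem1p3: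
  fixes r L k :: nat and lam :: "nat \<Rightarrow> nat" and M :: "nat \<Rightarrow> int"
  assumes "r \<ge> 1" and "L \<ge> 1"
    and "lam \<in> partitions (r + 1) (k * L)"
    and "M 0 = int (k * L)" and "M (r + 1) = 0"
    and "\<And>i. i \<in> {1..r + 1} \<Longrightarrow> int (lam i) = M (i - 1) - M i"
  shows "multiplicity_in_tensor_power r k L lam =
           shift_op (weyl_denominator r) (weight_coeff r k L) M"
proof -
  have "with_boundary r (int (k * L)) M = M"
    using assms(4,5) by (auto simp: with_boundary_def)
  then have weight: "weight r (int (k * L)) M i = int (lam i)" if "i \<in> {1..r + 1}" for i
    using assms(6)[OF that] by (simp add: weight_def)
  have "shift_op (weyl_denominator r) (weight_coeff r k L) M =
      int_coeff (r + 1) (vandermonde (r + 1) vars * tensor_power_char r k L)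
        (\<lambda>i. int (lam i + (r + 1 - i)))"
    unfolding shift_op_weyl_denominator_weight_coeff by (rule int_coeff_cong) (simp only: weight of_nat_add)
  \<comment> \<open>All exponents are natural numbers here, so the zero convention does not
    intervene.\<close>
  also have "\<dots> = Poly_Mapping.lookup (vandermonde (r + 1) vars * tensor_power_char r k L)
      (\<Sum>i=1..r + 1. Poly_Mapping.single i (lam i + (r + 1 - i)))"
    by (simp only: int_coeff_def nat_int of_nat_0_le_iff ball_triv simp_thms if_True)
  also have "(\<Sum>i=1..r + 1. Poly_Mapping.single i (lam i + (r + 1 - i))) =
      exponent (r + 1) (\<lambda>i. lam (Suc i) + (r + 1 - Suc i))"
    unfolding exponent_def
    by (rule sum.reindex_bij_witness[of _ Suc "\<lambda>i. i - 1"]) auto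
  finally show ?thesis
    by (simp only: multiplicity_eq_lookup[OF assms(3)])
qed

end
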